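(* There is a function $h:(0,\infty)\to\mathbb{R}$ with $h(\varepsilon)\to 0$ as $\varepsilon\to 0^+$ such that for every orderon $W$ and every $\varepsilon>0$ there exists a simple ordered graph $G$ on at most $2^{\varepsilon^{-3+h(\varepsilon)}}$ vertices (that is, at most $2^{\varepsilon^{-3+o(1)}}$ vertices) such that $d_\triangle(W,W_G)\le\varepsilon$.
   Context: An orderon is a (Lebesgue) measurable function $W:([0,1]^2)^2\to[0,1]$ with $W(u,v)=W(v,u)$ for all $u,v\in[0,1]^2$. A measure-preserving bijection of $[0,1]^2$ is a bijection $f:[0,1]^2\to[0,1]^2$ such that both $f$ and $f^{-1}$ are measure preserving for Lebesgue measure; $\mathcal{F}$ is the set of all of them. For $f\in\mathcal{F}$, $W^f(u,v)=W(f(u),f(v))$, and $\mathrm{Shift}(f)=\sup_{(x,a)\in[0,1]^2}|x-\pi_1(f(x,a))|$, where $\pi_1(y,b)=y$. The cut-norm of a symmetric measurable $V:([0,1]^2)^2\to\mathbb{R}$ is $\|V\|_\square=\sup_{S,T\subseteq[0,1]^2}\left|\int_{S\times T}V(u,v)\,du\,dv\right|$ over measurable $S,T$. The cut-shift distance is $d_\triangle(W,U)=\inf_{f\in\mathcal{F}}\left(\mathrm{Shift}(f)+\|W-U^f\|_\square\right)$. A simple ordered graph on $n$ vertices is a symmetric function $G:[n]^2\to\{0,1\}$ with $G(i,i)=0$ for all $i$. Its orderon representation is $W_G((x,a),(y,b))=G(Q_n(x),Q_n(y))$, where $Q_n(x)=\lceil nx\rceil$ for $x>0$ and $Q_n(0)=1$.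 *)

theory Defs
  imports "HOL-Analysis.Analysis"
begin

abbreviation unit_square :: "(real \<times> real) set" where
  "unit_square \<equiv> {0..1} \<times> {0..1}"

text \<open>Functions on the unit square are total functions on the plane whose values outside
  the square are irrelevant. ``Measurable'' means Lebesgue measurable throughout.\<close>

definition orderon :: "(real \<times> real \<Rightarrow> real \<times> real \<Rightarrow> real) \<Rightarrow> bool" where
  "orderon W \<longleftrightarrow>
     (\<lambda>p. W (fst p) (snd p)) \<in> borel_measurable (lebesgue_on (unit_square \<times> unit_square)) \<and>
     (\<forall>u\<in>unit_square. \<forall>v\<in>unit_square. W u v \<in> {0..1} \<and> W u v = W v u)"

definition measure_preserving :: "'a measure \<Rightarrow> 'b measure \<Rightarrow> ('a \<Rightarrow> 'b) \<Rightarrow> bool" where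
  "measure_preserving M N f \<longleftrightarrow> f \<in> measurable M N \<and>
     (\<forall>A\<in>sets N. emeasure M (f -` A \<inter> space M) = emeasure N A)"

definition mp_bijections :: "(real \<times> real \<Rightarrow> real \<times> real) set" where
  "mp_bijections = {f. bij_betw f unit_square unit_square \<and>
     measure_preserving (lebesgue_on unit_square) (lebesgue_on unit_square) f \<and>
     measure_preserving (lebesgue_on unit_square) (lebesgue_on unit_square)
       (inv_into unit_square f)}"

definition relabel :: "(real \<times> real \<Rightarrow> real \<times> real \<Rightarrow> real) \<Rightarrow>
    (real \<times> real \<Rightarrow> real \<times> real) \<Rightarrow> (real \<times> real \<Rightarrow> real \<times> real \<Rightarrow> real)" where
  "relabel W f = (\<lambda>u v. W (f u) (f v))"

definition Shift :: "(real \<times> real \<Rightarrow> real \<times> real) \<Rightarrow> real" where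
  "Shift f = (SUP u\<in>unit_square. \<bar>fst u - fst (f u)\<bar>)"

text \<open>The supremum is a real one; it is meaningful for \<open>V\<close> integrable on the square of the unit
  square, in particular for differences of orderons, which are bounded there.\<close>

definition cut_norm :: "(real \<times> real \<Rightarrow> real \<times> real \<Rightarrow> real) \<Rightarrow> real" where
  "cut_norm V =
     (SUP (S, T) \<in> {S \<in> sets lebesgue. S \<subseteq> unit_square} \<times> {T \<in> sets lebesgue. T \<subseteq> unit_square}.
        \<bar>LINT p:S \<times> T|lebesgue. V (fst p) (snd p)\<bar>)"

definition cut_shift_dist :: "(real \<times> real \<Rightarrow> real \<times> real \<Rightarrow> real) \<Rightarrow>
    (real \<times> real \<Rightarrow> real \<times> real \<Rightarrow> real) \<Rightarrow> real" where
  "cut_shift_dist W U =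
     (INF f\<in>mp_bijections. Shift f + cut_norm (\<lambda>u v. W u v - relabel U f u v))"

text \<open>The vertex set is \<open>{1..n}\<close>. It is required to be nonempty, since the orderon
  representation below needs at least one vertex.\<close>

definition simple_ordered_graph :: "nat \<Rightarrow> (nat \<Rightarrow> nat \<Rightarrow> nat) \<Rightarrow> bool" where
  "simple_ordered_graph n G \<longleftrightarrow> n \<ge> 1 \<and>
     (\<forall>i\<in>{1..n}. \<forall>j\<in>{1..n}. G i j \<in> {0, 1} \<and> G i j = G j i) \<and>
     (\<forall>i\<in>{1..n}. G i i = 0)"

definition Q :: "nat \<Rightarrow> real \<Rightarrow> nat" where
  "Q n x = (if x = 0 then 1 else nat \<lceil>real n * x\<rceil>)"

definition graph_orderon ::
    "nat \<Rightarrow> (nat \<Rightarrow> nat \<Rightarrow> nat) \<Rightarrow> (real \<times> real \<Rightarrow> real \<times> real \<Rightarrow> real)" where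
  "graph_orderon n G = (\<lambda>u v. real (G (Q n (fst u)) (Q n (fst v))))"

end

theory Submission
  imports Defs
begin

text \<open>The second coordinate of the unit square is a reservoir of extra vertices sitting at the same
  position of the order. A graph orderon ignores that coordinate, so the information that an
  orderon stores along it has to be moved into the first coordinate. The cut-shift distance permits
  this as long as nothing moves far: inside a vertical strip of width \<open>1/L\<close> everything may be
  rearranged at a cost of \<open>1/L\<close>.

  After an \<open>L1\<close> approximation (\<open>orderon_step_approx\<close>) the orderon is an
  \<open>N \<times> N\<close> matrix indexed by the \<open>N = m * m\<close> cells of a fine grid. Weak regularity
  (\<open>weak_regularity\<close>) splits the cells into \<open>4^k\<close> classes such that, up to an error \<open>\<eta> = k^(-1/2)\<close>
  in cut norm, the matrix depends only on the classes. Within each of the \<open>L\<close> strips the cells are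
  sorted by class, and each cell is stretched affinely into a thin vertical strip at its new
  position (\<open>cell_map\<close>). Cutting the order into \<open>n = 4^k * L * L\<close> equal blocks, there are
  \<open>L\<close> times as many blocks as pairs (strip, class), so all but a fraction \<open>1/L\<close> of the blocks lie
  in one class. The matrix is thus close to one that is constant on pairs of blocks, and
  randomised rounding of its entries (\<open>graph_rounding\<close>) turns it into a simple graph on the
  \<open>n\<close> blocks. \<open>finite_order_approximation\<close> is this argument for matrices, and
  \<open>orderon_graph_approx\<close> transports it to the square.

  For \<open>\<epsilon> < 1\<close>, with \<open>k\<close> of order \<open>\<epsilon>^-2\<close> and \<open>L\<close> of order \<open>\<epsilon>^-1\<close> this gives \<open>n = 2^O(\<epsilon>^-2)\<close>, which is
  at most \<open>2^(164 \<epsilon>^-3)\<close>; the constant 164 is absorbed in the exponent by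
  \<open>h(\<epsilon>) = ln 164 / ln \<epsilon>\<close>.\<close>

section \<open>Rounding linear and bilinear forms\<close>


text \<open>A linear form on a box is extremal at a vertex, so a bound on the subset sums of the coefficients
  bounds the form. This and its bilinear version replace fractional weights (measures of
  intersections with cells, sizes of intersections with blocks) by genuine subsets.\<close>

lemma linear_form_rounding:
  fixes a s :: "'a \<Rightarrow> real"
  assumes A: "finite A" and \<beta>: "0 \<le> \<beta>" and s: "\<And>i. i \<in> A \<Longrightarrow> 0 \<le> s i \<and> s i \<le> \<beta>"
    and bound: "\<And>S. S \<subseteq> A \<Longrightarrow> \<bar>\<Sum>i\<in>S. a i\<bar> \<le> c"
  shows "\<bar>\<Sum>i\<in>A. s i * a i\<bar> \<le> \<beta> * c"
proof -
  let ?P = "{i\<in>A. a i > 0}" and ?M = "{i\<in>A. a i < 0}"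
  have "(\<Sum>i\<in>A. s i * a i) \<le> (\<Sum>i\<in>A. if a i > 0 then \<beta> * a i else 0)"
    by (rule sum_mono) (use s in \<open>auto simp: mult_right_mono mult_nonneg_nonpos\<close>)
  also have "\<dots> = \<beta> * (\<Sum>i\<in>?P. a i)"
    using A by (auto simp: sum.inter_filter sum_distrib_left intro!: sum.cong)
  also have "\<dots> \<le> \<beta> * c"
    using bound[of ?P] \<beta> by (intro mult_left_mono) auto
  finally have up: "(\<Sum>i\<in>A. s i * a i) \<le> \<beta> * c" .
  have "\<beta> * (- c) \<le> \<beta> * (\<Sum>i\<in>?M. a i)"
    using bound[of ?M] \<beta> by (intro mult_left_mono) auto
  also have "\<dots> = (\<Sum>i\<in>A. if a i < 0 then \<beta> * a i else 0)"
    using A by (auto simp: sum.inter_filter sum_distrib_left intro!: sum.cong)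
  also have "\<dots> \<le> (\<Sum>i\<in>A. s i * a i)"
    by (rule sum_mono) (use s in \<open>auto simp: mult_right_mono_neg\<close>)
  finally show ?thesis using up by (simp add: abs_le_iff)
qed

lemma bilinear_form_rounding:
  fixes M :: "'a \<Rightarrow> 'b \<Rightarrow> real"
  assumes A: "finite A" and B: "finite B" and \<beta>: "0 \<le> \<beta>"
    and s: "\<And>i. i \<in> A \<Longrightarrow> 0 \<le> s i \<and> s i \<le> \<beta>" and t: "\<And>j. j \<in> B \<Longrightarrow> 0 \<le> t j \<and> t j \<le> \<beta>"
    and bound: "\<And>S T. S \<subseteq> A \<Longrightarrow> T \<subseteq> B \<Longrightarrow> \<bar>\<Sum>i\<in>S. \<Sum>j\<in>T. M i j\<bar> \<le> c"
  shows "\<bar>\<Sum>i\<in>A. \<Sum>j\<in>B. s i * t j * M i j\<bar> \<le> \<beta>\<^sup>2 * c"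
proof -
  have "\<bar>\<Sum>i\<in>A. s i * (\<Sum>j\<in>B. t j * M i j)\<bar> \<le> \<beta> * (\<beta> * c)"
  proof (rule linear_form_rounding[OF A \<beta> s])
    fix S assume S: "S \<subseteq> A"
    have "(\<Sum>i\<in>S. \<Sum>j\<in>B. t j * M i j) = (\<Sum>j\<in>B. t j * (\<Sum>i\<in>S. M i j))"
      by (subst sum.swap) (simp add: sum_distrib_left)
    moreover have "\<bar>\<Sum>j\<in>B. t j * (\<Sum>i\<in>S. M i j)\<bar> \<le> \<beta> * c"
    proof (rule linear_form_rounding[OF B \<beta> t])
      fix T assume "T \<subseteq> B"
      then show "\<bar>\<Sum>j\<in>T. \<Sum>i\<in>S. M i j\<bar> \<le> c"
        using bound[OF S] by (subst sum.swap) auto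
    qed
    ultimately show "\<bar>\<Sum>i\<in>S. \<Sum>j\<in>B. t j * M i j\<bar> \<le> \<beta> * c" by simp
  qed
  then show ?thesis
    by (simp add: sum_distrib_left mult.assoc power2_eq_square)
qed

section \<open>Weak regularity\<close>

definition clamp01 :: "real \<Rightarrow> real" where "clamp01 x = max 0 (min 1 x)"

lemma clamp01_range: "0 \<le> clamp01 x" "clamp01 x \<le> 1"
  by (auto simp: clamp01_def)

lemma clamp01_dist: "0 \<le> d \<Longrightarrow> d \<le> 1 \<Longrightarrow> \<bar>d - clamp01 x\<bar> \<le> \<bar>d - x\<bar>"
  by (auto simp: clamp01_def)

text \<open>If the pair \<open>(S, T)\<close> witnesses that \<open>U\<close> is far from \<open>D\<close> in cut norm, then a step of length
  \<open>\<eta>\<close> in the direction of the indicator of \<open>S \<times> T\<close> brings \<open>U\<close> closer in \<open>L2\<close>. The direction is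
  symmetrised to keep \<open>U\<close> symmetric, which changes no inner product with the symmetric
  matrix \<open>D - U\<close>. Clamping to the unit interval can only help, because \<open>D\<close> takes values there.\<close>

lemma energy_decrement:
  fixes D U :: "nat \<Rightarrow> nat \<Rightarrow> real"
  assumes D: "\<And>i j. i < N \<Longrightarrow> j < N \<Longrightarrow> 0 \<le> D i j \<and> D i j \<le> 1 \<and> D i j = D j i"
    and U: "\<And>i j. i < N \<Longrightarrow> j < N \<Longrightarrow> U i j = U j i"
    and S: "S \<subseteq> {..<N}" and T: "T \<subseteq> {..<N}" and \<eta>: "\<eta> > 0"
    and big: "(\<Sum>i\<in>S. \<Sum>j\<in>T. D i j - U i j) * \<sigma> > \<eta> * real N ^ 2" and \<sigma>: "\<sigma> = 1 \<or> \<sigma> = -1"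
  defines "X \<equiv> (\<lambda>i j. (of_bool (i \<in> S \<and> j \<in> T) + of_bool (i \<in> T \<and> j \<in> S)) / 2 :: real)"
  shows "(\<Sum>i<N. \<Sum>j<N. (D i j - clamp01 (U i j + \<sigma> * \<eta> * X i j))\<^sup>2)
     \<le> (\<Sum>i<N. \<Sum>j<N. (D i j - U i j)\<^sup>2) - \<eta>\<^sup>2 * real N ^ 2"
proof -
  let ?V = "\<lambda>i j. D i j - U i j"
  have ST: "(\<Sum>i<N. \<Sum>j<N. ?V i j * of_bool (i \<in> A \<and> j \<in> B)) = (\<Sum>i\<in>A. \<Sum>j\<in>B. ?V i j)"
    if "A \<subseteq> {..<N}" "B \<subseteq> {..<N}" for A B
  proof -
    have "(\<Sum>i<N. \<Sum>j<N. ?V i j * of_bool (i \<in> A \<and> j \<in> B))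
       = (\<Sum>i<N. if i \<in> A then \<Sum>j<N. if j \<in> B then ?V i j else 0 else 0)"
    proof (rule sum.cong[OF refl])
      fix i
      show "(\<Sum>j<N. ?V i j * of_bool (i \<in> A \<and> j \<in> B)) = (if i \<in> A then \<Sum>j<N. if j \<in> B then ?V i j else 0 else 0)"
        by (cases "i \<in> A") (simp_all add: of_bool_def if_distrib[of "\<lambda>x. _ * x"] cong: if_cong)
    qed
    also have "\<dots> = (\<Sum>i\<in>{..<N} \<inter> A. \<Sum>j\<in>{..<N} \<inter> B. ?V i j)"
      by (simp add: sum.inter_restrict)
    also have "\<dots> = (\<Sum>i\<in>A. \<Sum>j\<in>B. ?V i j)" using that by (simp add: Int_absorb1)
    finally show ?thesis .
  qed
  have "(\<Sum>i\<in>T. \<Sum>j\<in>S. ?V i j) = (\<Sum>j\<in>S. \<Sum>i\<in>T. ?V i j)" by (rule sum.swap)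
  also have "\<dots> = (\<Sum>i\<in>S. \<Sum>j\<in>T. ?V i j)"
  proof (intro sum.cong refl)
    fix i j assume "i \<in> S" "j \<in> T"
    then have "i < N" "j < N" using S T by auto
    then have "D j i = D i j" "U j i = U i j" using D[of j i] U[of j i] by simp_all
    then show "?V j i = ?V i j" by simp
  qed
  finally have sym: "(\<Sum>i\<in>T. \<Sum>j\<in>S. ?V i j) = (\<Sum>i\<in>S. \<Sum>j\<in>T. ?V i j)" .
  have inner: "(\<Sum>i<N. \<Sum>j<N. ?V i j * X i j) = (\<Sum>i\<in>S. \<Sum>j\<in>T. ?V i j)"
  proof -
    have "(\<Sum>i<N. \<Sum>j<N. ?V i j * X i j)
      = (\<Sum>i<N. \<Sum>j<N. (?V i j * of_bool (i \<in> S \<and> j \<in> T) + ?V i j * of_bool (i \<in> T \<and> j \<in> S)) / 2)"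
      unfolding X_def by (simp only: distrib_left times_divide_eq_right)
    also have "\<dots> = ((\<Sum>i<N. \<Sum>j<N. ?V i j * of_bool (i \<in> S \<and> j \<in> T))
        + (\<Sum>i<N. \<Sum>j<N. ?V i j * of_bool (i \<in> T \<and> j \<in> S))) / 2"
      by (simp only: sum_divide_distrib[symmetric] sum.distrib)
    finally show ?thesis using ST[OF S T] ST[OF T S] sym by simp
  qed
  have "(\<Sum>i<N. \<Sum>j<N. (D i j - clamp01 (U i j + \<sigma> * \<eta> * X i j))\<^sup>2)
     \<le> (\<Sum>i<N. \<Sum>j<N. (?V i j)\<^sup>2 - 2 * \<sigma> * \<eta> * (?V i j * X i j) + \<eta>\<^sup>2)"
  proof (intro sum_mono)
    fix i j assume ij: "i \<in> {..<N}" "j \<in> {..<N}"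
    have "(D i j - clamp01 (U i j + \<sigma> * \<eta> * X i j))\<^sup>2 \<le> (D i j - (U i j + \<sigma> * \<eta> * X i j))\<^sup>2"
      using clamp01_dist D ij by (intro power2_le_iff_abs_le[THEN iffD2] abs_le_square_iff[THEN iffD1]) auto
    also have "\<dots> = (?V i j)\<^sup>2 - 2 * \<sigma> * \<eta> * (?V i j * X i j) + \<sigma>\<^sup>2 * \<eta>\<^sup>2 * (X i j)\<^sup>2"
      by (simp add: power2_eq_square algebra_simps)
    also have "\<sigma>\<^sup>2 * \<eta>\<^sup>2 * (X i j)\<^sup>2 \<le> \<eta>\<^sup>2"
    proof -
      have "(X i j)\<^sup>2 \<le> 1" by (auto simp: X_def power2_eq_square)
      moreover have "\<sigma>\<^sup>2 = 1" using \<sigma> by auto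
      ultimately show ?thesis by (simp add: mult_left_le)
    qed
    finally show "(D i j - clamp01 (U i j + \<sigma> * \<eta> * X i j))\<^sup>2
        \<le> (?V i j)\<^sup>2 - 2 * \<sigma> * \<eta> * (?V i j * X i j) + \<eta>\<^sup>2" by simp
  qed
  also have "\<dots> = (\<Sum>i<N. \<Sum>j<N. (?V i j)\<^sup>2) - 2 * \<eta> * ((\<Sum>i<N. \<Sum>j<N. ?V i j * X i j) * \<sigma>) + \<eta>\<^sup>2 * real N ^ 2"
    by (simp add: sum.distrib sum_subtractf sum_distrib_left[symmetric] power2_eq_square)
  also have "\<dots> \<le> (\<Sum>i<N. \<Sum>j<N. (?V i j)\<^sup>2) - \<eta>\<^sup>2 * real N ^ 2"
  proof -
    have "\<eta> * ((\<Sum>i<N. \<Sum>j<N. ?V i j * X i j) * \<sigma>) \<ge> \<eta> * (\<eta> * real N ^ 2)"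
      using big \<eta> inner by (intro mult_left_mono) auto
    then show ?thesis by (simp add: power2_eq_square mult.assoc)
  qed
  finally show ?thesis .
qed

text \<open>The Frieze-Kannan argument. The squared \<open>L2\<close> distance from \<open>D\<close> starts at most \<open>N\<^sup>2\<close> and every
  unsuccessful round lowers it by \<open>\<eta>\<^sup>2 N\<^sup>2\<close>, so \<open>k\<close> rounds suffice; if no earlier round
  succeeds, the distance after \<open>k\<close> rounds is \<open>0\<close>. Correcting \<open>U\<close> directly, instead of
  averaging \<open>D\<close> over the classes, keeps \<open>U\<close> symmetric and within \<open>[0, 1]\<close> without any
  division by class sizes. That \<open>U\<close> lives on the classes is expressed as a congruence property,
  which avoids passing to a matrix indexed by classes.\<close>

lemma weak_regularity:
  fixes D :: "nat \<Rightarrow> nat \<Rightarrow> real"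
  assumes D: "\<And>i j. i < N \<Longrightarrow> j < N \<Longrightarrow> 0 \<le> D i j \<and> D i j \<le> 1 \<and> D i j = D j i"
    and \<eta>: "\<eta> > 0" and k: "real k * \<eta>\<^sup>2 \<ge> 1"
  obtains l :: "nat \<Rightarrow> nat" and U :: "nat \<Rightarrow> nat \<Rightarrow> real"
  where "\<And>i. l i < 4 ^ k" "\<And>i j. 0 \<le> U i j \<and> U i j \<le> 1" "\<And>i j. U i j = U j i"
    "\<And>i i' j j'. l i = l i' \<Longrightarrow> l j = l j' \<Longrightarrow> U i j = U i' j'"
    "\<And>S T. S \<subseteq> {..<N} \<Longrightarrow> T \<subseteq> {..<N} \<Longrightarrow> \<bar>\<Sum>i\<in>S. \<Sum>j\<in>T. D i j - U i j\<bar> \<le> \<eta> * real N ^ 2"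
proof -
  define good :: "nat \<Rightarrow> (nat \<Rightarrow> nat) \<Rightarrow> (nat \<Rightarrow> nat \<Rightarrow> real) \<Rightarrow> bool" where
    "good r l U \<longleftrightarrow> (\<forall>i. l i < 4 ^ r) \<and> (\<forall>i j. 0 \<le> U i j \<and> U i j \<le> 1) \<and> (\<forall>i j. U i j = U j i)
       \<and> (\<forall>i i' j j'. l i = l i' \<longrightarrow> l j = l j' \<longrightarrow> U i j = U i' j')" for r l U
  define reg :: "(nat \<Rightarrow> nat \<Rightarrow> real) \<Rightarrow> bool" where
    "reg U \<longleftrightarrow> (\<forall>S T. S \<subseteq> {..<N} \<longrightarrow> T \<subseteq> {..<N} \<longrightarrow> \<bar>\<Sum>i\<in>S. \<Sum>j\<in>T. D i j - U i j\<bar> \<le> \<eta> * real N ^ 2)" for U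
  have "\<exists>l U. good r l U \<and> (reg U \<or> (\<Sum>i<N. \<Sum>j<N. (D i j - U i j)\<^sup>2) \<le> (1 - real r * \<eta>\<^sup>2) * real N ^ 2)" for r
  proof (induction r)
    case 0
    have "(\<Sum>i<N. \<Sum>j<N. (D i j - 0)\<^sup>2) \<le> (\<Sum>i<N. \<Sum>j<N. 1)"
      using D by (intro sum_mono) (auto intro: power_le_one)
    then show ?case
      by (intro exI[of _ "\<lambda>_. 0"] exI[of _ "\<lambda>_ _. 0"]) (auto simp: good_def power2_eq_square)
  next
    case (Suc r)
    then obtain l U where g: "good r l U"
      and U: "reg U \<or> (\<Sum>i<N. \<Sum>j<N. (D i j - U i j)\<^sup>2) \<le> (1 - real r * \<eta>\<^sup>2) * real N ^ 2" by blast
    show ?case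
    proof (cases "reg U")
      case True
      have "l i < 4 ^ Suc r" for i
      proof -
        have "l i < 4 ^ r" using g by (simp add: good_def)
        then show ?thesis by simp
      qed
      then have "good (Suc r) l U" using g unfolding good_def by blast
      then show ?thesis using True by blast
    next
      case False
      then obtain S T where S: "S \<subseteq> {..<N}" and T: "T \<subseteq> {..<N}"
        and big: "\<not> \<bar>\<Sum>i\<in>S. \<Sum>j\<in>T. D i j - U i j\<bar> \<le> \<eta> * real N ^ 2" unfolding reg_def by blast
      obtain \<sigma> :: real where \<sigma>: "\<sigma> = 1 \<or> \<sigma> = -1"
        and big': "(\<Sum>i\<in>S. \<Sum>j\<in>T. D i j - U i j) * \<sigma> > \<eta> * real N ^ 2"
      proof (cases "(\<Sum>i\<in>S. \<Sum>j\<in>T. D i j - U i j) \<ge> 0")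
        case True
        then show ?thesis using that[of 1] big by simp
      next
        case False
        then show ?thesis using that[of "-1"] big by simp
      qed
      define X where "X = (\<lambda>i j. (of_bool (i \<in> S \<and> j \<in> T) + of_bool (i \<in> T \<and> j \<in> S)) / 2 :: real)"
      define U' where "U' = (\<lambda>i j. clamp01 (U i j + \<sigma> * \<eta> * X i j))"
      \<comment> \<open>One round appends two bits, membership in \<open>S\<close> and in \<open>T\<close>, to the class number.\<close>
      define l' where "l' = (\<lambda>i. 4 * l i + (2 * of_bool (i \<in> S) + of_bool (i \<in> T)))"
      have l'_eq: "l i = l i' \<and> (i \<in> S) = (i' \<in> S) \<and> (i \<in> T) = (i' \<in> T)" if "l' i = l' i'" for i i'
        using that unfolding l'_def of_bool_def by (auto split: if_splits; presburger)
      have U_sym: "U i j = U j i" for i j using g unfolding good_def by blast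
      have "good (Suc r) l' U'"
        unfolding good_def
      proof (intro conjI allI impI)
        fix i
        have "l i < 4 ^ r" using g by (simp add: good_def)
        then show "l' i < 4 ^ Suc r" by (auto simp: l'_def of_bool_def)
      next
        fix i j
        note U_sym[of i j]
        moreover have "X i j = X j i" by (simp add: X_def add.commute conj_commute)
        ultimately show "U' i j = U' j i" by (simp add: U'_def)
      next
        fix i i' j j' assume "l' i = l' i'" "l' j = l' j'"
        then have e: "l i = l i'" "l j = l j'" "X i j = X i' j'"
          using l'_eq[of i i'] l'_eq[of j j'] by (simp_all add: X_def)
        from e(1,2) have "U i j = U i' j'" using g unfolding good_def by blast
        then show "U' i j = U' i' j'" using e(3) by (simp add: U'_def)
      qed (auto simp: U'_def clamp01_range)
      moreover have "(\<Sum>i<N. \<Sum>j<N. (D i j - U' i j)\<^sup>2) \<le> (\<Sum>i<N. \<Sum>j<N. (D i j - U i j)\<^sup>2) - \<eta>\<^sup>2 * real N ^ 2"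
        unfolding U'_def X_def
        by (rule energy_decrement[OF D U_sym S T \<eta> big' \<sigma>])
      then have "(\<Sum>i<N. \<Sum>j<N. (D i j - U' i j)\<^sup>2) \<le> (1 - real (Suc r) * \<eta>\<^sup>2) * real N ^ 2"
        using U False by (simp add: algebra_simps)
      ultimately show ?thesis by blast
    qed
  qed
  then obtain l U where g: "good k l U"
    and U: "reg U \<or> (\<Sum>i<N. \<Sum>j<N. (D i j - U i j)\<^sup>2) \<le> (1 - real k * \<eta>\<^sup>2) * real N ^ 2" by blast
  have "reg U"
  proof (rule ccontr)
    assume n: "\<not> reg U"
    then have "(\<Sum>i<N. \<Sum>j<N. (D i j - U i j)\<^sup>2) \<le> (1 - real k * \<eta>\<^sup>2) * real N ^ 2" using U by blast
    also have "\<dots> \<le> 0" using k by (simp add: mult_nonpos_nonneg)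
    finally have "(\<Sum>i<N. \<Sum>j<N. (D i j - U i j)\<^sup>2) = 0"
      by (intro order_antisym sum_nonneg) auto
    then have z: "D i j - U i j = 0" if "i < N" "j < N" for i j
      using that by (simp add: sum_nonneg_eq_0_iff sum_nonneg)
    have "(\<Sum>i\<in>S. \<Sum>j\<in>T. D i j - U i j) = 0" if "S \<subseteq> {..<N}" "T \<subseteq> {..<N}" for S T
      using that z by (intro sum.neutral ballI) (auto simp: subset_iff)
    then show False using n \<eta> by (simp add: reg_def)
  qed
  then show thesis using g that[of l U] unfolding good_def reg_def by blast
qed

section \<open>Rounding a density matrix to a graph\<close>

lemma exp_le_quadratic:
  fixes x :: real
  assumes "\<bar>x\<bar> \<le> 1"
  shows "exp x \<le> 1 + x + x\<^sup>2"
proof (cases "x \<ge> 0")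
  case True
  then show ?thesis using exp_bound[of x] assms by simp
next
  case False
  define y where "y = - x"
  have y: "0 \<le> y" using False by (simp add: y_def)
  have "1 \<le> 1 + y ^ 3" using y by simp
  also have "\<dots> = (1 - y + y\<^sup>2) * (1 + y)" by (simp add: algebra_simps power2_eq_square power3_eq_cube)
  also have "\<dots> \<le> (1 - y + y\<^sup>2) * exp y"
  proof (rule mult_left_mono)
    have "1 - y + y\<^sup>2 = (1 - y / 2)\<^sup>2 + 3 / 4 * y\<^sup>2" by (simp add: power2_eq_square field_simps)
    then show "0 \<le> 1 - y + y\<^sup>2" by simp
  qed (rule exp_ge_add_one_self)
  finally show ?thesis by (simp add: y_def exp_minus field_simps)
qed

text \<open>The centred Bernoulli variable has mean zero, so only the quadratic term survives.\<close>

lemma exp_moment_bernoulli: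
  fixes p x :: real
  assumes p: "0 \<le> p" "p \<le> 1" and x: "\<bar>x\<bar> \<le> 1"
  shows "p * exp (x * (1 - p)) + (1 - p) * exp (x * (0 - p)) \<le> exp (x\<^sup>2)"
proof -
  have b: "\<bar>x * (1 - p)\<bar> \<le> 1" "\<bar>x * (0 - p)\<bar> \<le> 1"
    using p x by (auto simp: abs_mult intro!: mult_le_one)
  have "p * exp (x * (1 - p)) + (1 - p) * exp (x * (0 - p))
     \<le> p * (1 + x * (1 - p) + (x * (1 - p))\<^sup>2) + (1 - p) * (1 + x * (0 - p) + (x * (0 - p))\<^sup>2)"
    using p by (intro add_mono mult_left_mono exp_le_quadratic b) auto
  also have "\<dots> = 1 + x\<^sup>2 * (p * (1 - p))"
    by (simp add: power2_eq_square algebra_simps)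
  also have "\<dots> \<le> 1 + x\<^sup>2 * 1"
    using p by (intro add_left_mono mult_left_mono mult_le_one) auto
  also have "\<dots> \<le> exp (x\<^sup>2)" using exp_ge_add_one_self[of "x\<^sup>2"] by simp
  finally show ?thesis .
qed

text \<open>Randomised rounding by the method of conditional expectations. The potential is the sum over all
  tests \<open>f\<close> of the exponential of the signed error. Averaged over the two values of \<open>g e\<close> with
  weights \<open>p e\<close> and \<open>1 - p e\<close>, one more entry multiplies it by at most \<open>exp (\<kappa>\<^sup>2)\<close>; one
  of the two values does at least as well as the average.\<close>

lemma rounding_potential:
  fixes a :: "'f \<Rightarrow> 'e \<Rightarrow> real" and p :: "'e \<Rightarrow> real" and \<kappa> :: real
  assumes E: "finite E" and p: "\<And>e. 0 \<le> p e \<and> p e \<le> 1"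
    and a: "\<And>f e. \<bar>a f e\<bar> \<le> \<kappa>" and \<kappa>: "\<kappa> \<le> 1"
  shows "\<exists>g :: 'e \<Rightarrow> nat. (\<forall>e. g e \<in> {0, 1}) \<and>
    (\<Sum>f\<in>F. exp (\<Sum>e\<in>E. a f e * (real (g e) - p e))) \<le> card F * exp (card E * \<kappa>\<^sup>2)"
  using E
proof (induction E)
  case empty
  then show ?case by (intro exI[of _ "\<lambda>_. 0"]) simp
next
  case (insert e0 E)
  then obtain g :: "'e \<Rightarrow> nat" where g: "\<And>e. g e \<in> {0, 1}"
    and IH: "(\<Sum>f\<in>F. exp (\<Sum>e\<in>E. a f e * (real (g e) - p e))) \<le> card F * exp (card E * \<kappa>\<^sup>2)" by blast
  define \<Phi> where "\<Phi> f = exp (\<Sum>e\<in>E. a f e * (real (g e) - p e))" for f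
  define \<Psi> where "\<Psi> v = (\<Sum>f\<in>F. \<Phi> f * exp (a f e0 * (v - p e0)))" for v :: real
  have upd: "(\<Sum>f\<in>F. exp (\<Sum>e\<in>insert e0 E. a f e * (real ((g(e0 := v)) e) - p e))) = \<Psi> (real v)" for v
  proof -
    have "(\<Sum>e\<in>E. a f e * (real ((g(e0 := v)) e) - p e)) = (\<Sum>e\<in>E. a f e * (real (g e) - p e))" for f
      using insert.hyps by (intro sum.cong) auto
    then show ?thesis
      using insert.hyps by (simp add: \<Psi>_def \<Phi>_def exp_add mult.commute)
  qed
  have "p e0 * \<Psi> 1 + (1 - p e0) * \<Psi> 0
    = (\<Sum>f\<in>F. \<Phi> f * (p e0 * exp (a f e0 * (1 - p e0)) + (1 - p e0) * exp (a f e0 * (0 - p e0))))"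
    by (simp add: \<Psi>_def sum_distrib_left sum.distrib[symmetric] algebra_simps)
  also have "\<dots> \<le> (\<Sum>f\<in>F. \<Phi> f * exp (\<kappa>\<^sup>2))"
  proof (intro sum_mono mult_left_mono)
    fix f
    have "\<bar>a f e0\<bar> \<le> 1" using a[of f e0] \<kappa> by simp
    then have "p e0 * exp (a f e0 * (1 - p e0)) + (1 - p e0) * exp (a f e0 * (0 - p e0)) \<le> exp ((a f e0)\<^sup>2)"
      using p[of e0] by (intro exp_moment_bernoulli) auto
    also have "\<dots> \<le> exp (\<kappa>\<^sup>2)" using a[of f e0] by (simp add: abs_le_square_iff[symmetric])
    finally show "p e0 * exp (a f e0 * (1 - p e0)) + (1 - p e0) * exp (a f e0 * (0 - p e0)) \<le> exp (\<kappa>\<^sup>2)" .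
  qed (simp add: \<Phi>_def)
  also have "\<dots> = (\<Sum>f\<in>F. \<Phi> f) * exp (\<kappa>\<^sup>2)" by (simp add: sum_distrib_right)
  also have "\<dots> \<le> (card F * exp (card E * \<kappa>\<^sup>2)) * exp (\<kappa>\<^sup>2)"
    using IH by (intro mult_right_mono) (simp_all add: \<Phi>_def)
  also have "\<dots> = card F * exp (card (insert e0 E) * \<kappa>\<^sup>2)"
    using insert.hyps by (simp add: exp_add algebra_simps)
  finally have avg: "p e0 * \<Psi> 1 + (1 - p e0) * \<Psi> 0 \<le> card F * exp (card (insert e0 E) * \<kappa>\<^sup>2)" .
  obtain v :: nat where v: "v \<in> {0, 1}" "\<Psi> v \<le> card F * exp (card (insert e0 E) * \<kappa>\<^sup>2)"
  proof (cases "\<Psi> 1 \<le> \<Psi> 0")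
    case True
    then have "\<Psi> 1 \<le> p e0 * \<Psi> 1 + (1 - p e0) * \<Psi> 0"
      using p[of e0] mult_left_mono[OF True, of "1 - p e0"] by (simp add: algebra_simps)
    then show thesis using avg that[of 1] by simp
  next
    case False
    then have "\<Psi> 0 \<le> p e0 * \<Psi> 1 + (1 - p e0) * \<Psi> 0"
      using p[of e0] mult_left_mono[of "\<Psi> 0" "\<Psi> 1" "p e0"] by (simp add: algebra_simps)
    then show thesis using avg that[of 0] by simp
  qed
  show ?case
  proof (intro exI conjI allI)
    show "(g(e0 := v)) e \<in> {0, 1}" for e using g v by auto
    show "(\<Sum>f\<in>F. exp (\<Sum>e\<in>insert e0 E. a f e * (real ((g(e0 := v)) e) - p e)))
      \<le> card F * exp (card (insert e0 E) * \<kappa>\<^sup>2)" using upd v(2) by simp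
  qed
qed

text \<open>The rounded entries are only those above the diagonal; this form of the double sum collects the two
  coefficients which each of them carries.\<close>

lemma sum_square_split:
  fixes h :: "nat \<Rightarrow> nat \<Rightarrow> real"
  shows "(\<Sum>i<n. \<Sum>j<n. h i j) = (\<Sum>i<n. h i i) + (\<Sum>(i, j) \<in> {(i, j). i < j \<and> j < n}. h i j + h j i)"
proof -
  let ?E = "{(i, j). i < j \<and> j < n}" and ?E' = "{(i, j). j < i \<and> i < n}"
  have fin: "finite ?E" "finite ?E'"
    by (rule finite_subset[of _ "{..<n} \<times> {..<n}"]; force)+
  have sq: "{..<n} \<times> {..<n} = (\<lambda>i. (i, i)) ` {..<n} \<union> (?E \<union> ?E')" by auto
  have "(\<Sum>i<n. \<Sum>j<n. h i j) = (\<Sum>(i, j)\<in>{..<n} \<times> {..<n}. h i j)"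
    by (simp add: sum.cartesian_product)
  also have "\<dots> = (\<Sum>(i, j)\<in>(\<lambda>i. (i, i)) ` {..<n}. h i j) + ((\<Sum>(i, j)\<in>?E. h i j) + (\<Sum>(i, j)\<in>?E'. h i j))"
    unfolding sq using fin by (subst sum.union_disjoint; (subst sum.union_disjoint)?; auto)
  also have "(\<Sum>(i, j)\<in>(\<lambda>i. (i, i)) ` {..<n}. h i j) = (\<Sum>i<n. h i i)"
    by (subst sum.reindex) (auto simp: inj_on_def)
  also have "(\<Sum>(i, j)\<in>?E'. h i j) = (\<Sum>(i, j)\<in>?E. h j i)"
    by (rule sum.reindex_bij_witness[of _ "\<lambda>(i, j). (j, i)" "\<lambda>(i, j). (j, i)"]) auto
  finally show ?thesis by (simp add: sum.distrib[symmetric] case_prod_unfold)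
qed

text \<open>A union bound over the \<open>4 ^ n\<close> pairs \<open>(S, T)\<close> and both signs. The error is of order \<open>n powr (3/2)\<close>,
  which for \<open>n = r\<^sup>2\<close> is the order of \<open>r * n\<close>; the choice of \<open>n\<close> as a square keeps square roots
  out of the statement. Erasing the diagonal costs at most another \<open>n\<close>.\<close>

lemma graph_rounding:
  fixes P :: "nat \<Rightarrow> nat \<Rightarrow> real"
  assumes P: "\<And>i j. 0 \<le> P i j \<and> P i j \<le> 1" "\<And>i j. P i j = P j i"
    and r: "r \<ge> 1" and n: "n = r ^ 2"
  obtains G :: "nat \<Rightarrow> nat \<Rightarrow> nat"
  where "\<And>i j. G i j \<in> {0, 1}" "\<And>i j. G i j = G j i" "\<And>i. G i i = 0"
    "\<And>S T. S \<subseteq> {..<n} \<Longrightarrow> T \<subseteq> {..<n} \<Longrightarrow> \<bar>\<Sum>i\<in>S. \<Sum>j\<in>T. P i j - real (G i j)\<bar> \<le> 9 * real r * real n"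
proof -
  define E where "E = {(i :: nat, j). i < j \<and> j < n}"
  define F where "F = Pow {..<n} \<times> Pow {..<n} \<times> {1, -1 :: real}"
  define ind where "ind S T i j = (of_bool (i \<in> S \<and> j \<in> T) :: real)" for S T :: "nat set" and i j
  \<comment> \<open>An entry above the diagonal is counted at most twice, so the factor \<open>1 / (2 * r)\<close> makes the
    coefficients at most \<open>1 / r\<close>. Then the sum of their squares, like the logarithm of the number
    of tests, is of order \<open>n\<close>. The guard on \<open>\<sigma>\<close> gives the bound for arguments outside \<open>F\<close> too.\<close>
  define a where "a = (\<lambda>(S, T, \<sigma> :: real) (i, j). if \<bar>\<sigma>\<bar> = 1 then \<sigma> * (ind S T i j + ind S T j i) / (2 * r) else 0)"
  have n1: "n \<ge> 1" using r n by simp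
  have E: "finite E" "card E \<le> n\<^sup>2"
  proof -
    have s: "E \<subseteq> {..<n} \<times> {..<n}" by (auto simp: E_def)
    then show "finite E" by (rule finite_subset) simp
    show "card E \<le> n\<^sup>2" using card_mono[OF _ s] by (simp add: power2_eq_square)
  qed
  have "\<bar>a f e\<bar> \<le> 1 / r" for f e
  proof -
    obtain S T \<sigma> i j where fe: "f = (S, T, \<sigma>)" "e = (i, j)" by (metis surj_pair)
    have "\<bar>\<sigma> * (ind S T i j + ind S T j i) / (2 * r)\<bar> \<le> 1 / r" if "\<bar>\<sigma>\<bar> = 1"
      using that r by (auto simp: ind_def abs_mult field_simps)
    then show ?thesis using r by (simp add: a_def fe)
  qed
  then obtain g :: "nat \<times> nat \<Rightarrow> nat" where g: "\<And>e. g e \<in> {0, 1}"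
    and bd: "(\<Sum>f\<in>F. exp (\<Sum>e\<in>E. a f e * (real (g e) - P (fst e) (snd e)))) \<le> card F * exp (card E * (1 / r)\<^sup>2)"
    using rounding_potential[where E = E and p = "\<lambda>e. P (fst e) (snd e)" and a = a and \<kappa> = "1 / real r" and F = F] E(1) P(1) r by auto
  have "card F * exp (card E * (1 / r)\<^sup>2) \<le> exp (4 * real n)"
  proof -
    have cF: "card F = 2 ^ n * (2 ^ n * 2)" by (simp add: F_def card_Pow card_cartesian_product)
    have "real (card F) = 4 ^ n * 2" unfolding cF by (simp add: power_mult_distrib[symmetric])
    also have "\<dots> \<le> 4 ^ n * 2 ^ n" using n1 by (simp add: self_le_power)
    also have "\<dots> = 8 ^ n" by (simp add: power_mult_distrib[symmetric])
    also have "\<dots> \<le> (exp 3) ^ n"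
    proof (rule power_mono)
      have "(8 :: real) = 2 ^ 3" by simp
      also have "\<dots> \<le> exp 1 ^ 3" by (intro power_mono) (use exp_ge_add_one_self[of 1] in auto)
      finally show "(8 :: real) \<le> exp 3" by (simp add: exp_of_nat_mult[symmetric])
    qed simp
    finally have c: "real (card F) \<le> exp (3 * real n)" by (simp add: exp_of_nat_mult[symmetric] mult.commute)
    have "real (card E) * (1 / r)\<^sup>2 \<le> real n"
    proof -
      have "real (card E) \<le> real (n\<^sup>2)" using E(2) by (rule of_nat_mono)
      then show ?thesis using r by (simp add: n field_simps power2_eq_square)
    qed
    then have "card F * exp (card E * (1 / r)\<^sup>2) \<le> exp (3 * real n) * exp (real n)"
      using c by (intro mult_mono) auto
    then show ?thesis by (simp add: exp_add[symmetric])
  qed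
  with bd have total: "(\<Sum>f\<in>F. exp (\<Sum>e\<in>E. a f e * (real (g e) - P (fst e) (snd e)))) \<le> exp (4 * real n)" by linarith
  have finF: "finite F" by (simp add: F_def)
  have each: "(\<Sum>e\<in>E. a f e * (real (g e) - P (fst e) (snd e))) \<le> 4 * real n" if "f \<in> F" for f
  proof -
    have "exp (\<Sum>e\<in>E. a f e * (real (g e) - P (fst e) (snd e))) \<le> (\<Sum>f\<in>F. exp (\<Sum>e\<in>E. a f e * (real (g e) - P (fst e) (snd e))))"
      using finF that by (intro member_le_sum) auto
    then have "exp (\<Sum>e\<in>E. a f e * (real (g e) - P (fst e) (snd e))) \<le> exp (4 * real n)" using total by linarith
    then show ?thesis by simp
  qed
  define G where "G i j = (if i = j then 0 else g (min i j, max i j))" for i j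
  have G01: "G i j \<in> {0, 1}" for i j using g by (simp add: G_def)
  have Gsym: "G i j = G j i" for i j by (simp add: G_def min.commute max.commute)
  show thesis
  proof (rule that[of G])
    fix S T assume S: "S \<subseteq> {..<n}" and T: "T \<subseteq> {..<n}"
    let ?h = "\<lambda>i j. ind S T i j * (P i j - real (G i j))"
    have "(\<Sum>i\<in>S. \<Sum>j\<in>T. P i j - real (G i j)) = (\<Sum>i<n. \<Sum>j<n. ?h i j)"
    proof -
      have "(\<Sum>i<n. \<Sum>j<n. ?h i j) = (\<Sum>i<n. if i \<in> S then \<Sum>j<n. if j \<in> T then P i j - real (G i j) else 0 else 0)"
      proof (rule sum.cong[OF refl])
        fix i
        show "(\<Sum>j<n. ?h i j) = (if i \<in> S then \<Sum>j<n. if j \<in> T then P i j - real (G i j) else 0 else 0)"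
          by (cases "i \<in> S") (simp_all add: ind_def of_bool_def if_distrib[of "\<lambda>x. x * _"] cong: if_cong)
      qed
      also have "\<dots> = (\<Sum>i\<in>{..<n} \<inter> S. \<Sum>j\<in>{..<n} \<inter> T. P i j - real (G i j))"
        by (simp add: sum.inter_restrict)
      finally show ?thesis using S T by (simp add: Int_absorb1)
    qed
    also have "\<dots> = (\<Sum>i<n. ?h i i) + (\<Sum>(i, j)\<in>E. ?h i j + ?h j i)"
      unfolding E_def by (rule sum_square_split)
    finally have split: "(\<Sum>i\<in>S. \<Sum>j\<in>T. P i j - real (G i j)) = (\<Sum>i<n. ?h i i) + (\<Sum>(i, j)\<in>E. ?h i j + ?h j i)" .
    have diag: "\<bar>\<Sum>i<n. ?h i i\<bar> \<le> real n"
    proof -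
      have "\<bar>\<Sum>i<n. ?h i i\<bar> \<le> (\<Sum>i<n. 1)"
        by (rule order_trans[OF sum_abs], rule sum_mono) (use P in \<open>auto simp: ind_def G_def\<close>)
      then show ?thesis by simp
    qed
    have side: "- \<sigma> * (\<Sum>(i, j)\<in>E. ?h i j + ?h j i) \<le> 8 * real r * real n" if \<sigma>: "\<sigma> \<in> {1, -1}" for \<sigma>
    proof -
      have "(S, T, \<sigma>) \<in> F" using S T \<sigma> by (auto simp: F_def)
      from each[OF this] have "(\<Sum>e\<in>E. a (S, T, \<sigma>) e * (g e - P (fst e) (snd e))) \<le> 4 * real n" .
      moreover have "2 * real r * (\<Sum>e\<in>E. a (S, T, \<sigma>) e * (g e - P (fst e) (snd e))) = - \<sigma> * (\<Sum>(i, j)\<in>E. ?h i j + ?h j i)"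
        unfolding sum_distrib_left
      proof (rule sum.cong[OF refl])
        fix e assume "e \<in> E"
        then obtain i j where e: "e = (i, j)" "i < j" by (auto simp: E_def)
        have "P j i = P i j" by (rule P(2))
        moreover have "\<bar>\<sigma>\<bar> = 1" using \<sigma> by auto
        ultimately show "2 * real r * (a (S, T, \<sigma>) e * (g e - P (fst e) (snd e))) = - \<sigma> * (case e of (i, j) \<Rightarrow> ?h i j + ?h j i)"
          using e r by (simp add: a_def G_def field_simps)
      qed
      moreover have "2 * real r * (\<Sum>e\<in>E. a (S, T, \<sigma>) e * (g e - P (fst e) (snd e))) \<le> 2 * real r * (4 * real n)"
        using calculation(1) by (intro mult_left_mono) auto
      ultimately show ?thesis by simp
    qed
    have "real n \<le> real r * real n" using r mult_right_mono[of 1 "real r" "real n"] by simp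
    then show "\<bar>\<Sum>i\<in>S. \<Sum>j\<in>T. P i j - real (G i j)\<bar> \<le> 9 * real r * real n"
      using side[of 1] side[of "-1"] diag unfolding split by simp
  qed (use G01 Gsym in \<open>auto simp: G_def\<close>)
qed

section \<open>Sorting the cells into blocks\<close>

lemma sorting_permutation:
  fixes key :: "nat \<Rightarrow> nat"
  obtains \<pi> where "bij_betw \<pi> {..<N} {..<N}"
    "\<And>q q'. q \<le> q' \<Longrightarrow> q' < N \<Longrightarrow> key (\<pi> q) \<le> key (\<pi> q')"
proof -
  define xs where "xs = sort_key key [0..<N]"
  have len: "length xs = N" by (simp add: xs_def)
  have "bij_betw (\<lambda>q. xs ! q) {..<N} {..<N}"
    by (rule bij_betw_nth) (auto simp: xs_def)
  moreover have "key (xs ! q) \<le> key (xs ! q')" if "q \<le> q'" "q' < N" for q q'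
  proof -
    have "sorted (map key xs)" by (simp add: xs_def)
    from sorted_nth_mono[OF this that(1)] show ?thesis using that len by simp
  qed
  ultimately show thesis by (rule that)
qed

text \<open>A function has only one monotone rearrangement, so a permutation that keeps \<open>h\<close> monotone fixes \<open>h\<close>.
  Applied to \<open>h q = q div w\<close>, it shows that sorting by a key whose leading digit is the strip
  leaves every cell in its strip.\<close>

lemma monotone_rearrangement_unique:
  fixes \<pi> :: "nat \<Rightarrow> nat" and h :: "nat \<Rightarrow> nat"
  assumes \<pi>: "bij_betw \<pi> {..<N} {..<N}"
    and h: "\<And>q q'. q \<le> q' \<Longrightarrow> q' < N \<Longrightarrow> h q \<le> h q'"
    and h\<pi>: "\<And>q q'. q \<le> q' \<Longrightarrow> q' < N \<Longrightarrow> h (\<pi> q) \<le> h (\<pi> q')"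
    and q: "q < N"
  shows "h (\<pi> q) = h q"
proof -
  have "mset (map \<pi> [0..<N]) = mset [0..<N]"
  proof (rule set_eq_iff_mset_eq_distinct[THEN iffD1])
    show "distinct (map \<pi> [0..<N])"
      using \<pi> by (simp add: distinct_map bij_betw_def lessThan_atLeast0)
    show "set (map \<pi> [0..<N]) = set [0..<N]"
      using \<pi> by (simp add: bij_betw_def lessThan_atLeast0)
  qed simp
  then have "mset (map h (map \<pi> [0..<N])) = mset (map h [0..<N])" by (simp only: mset_map)
  moreover have "sorted (map h (map \<pi> [0..<N]))" "sorted (map h [0..<N])"
    using h h\<pi> by (auto simp: sorted_iff_nth_mono)
  ultimately have "map h (map \<pi> [0..<N]) = map h [0..<N]"
    using properties_for_sort by metis
  from arg_cong[OF this, of "\<lambda>xs. xs ! q"] show ?thesis using q by (simp only: nth_map length_map length_upt nth_upt) simp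
qed

lemma block_bounds: "q div b * b \<le> q" "q < q div b * b + b" if "b > 0" for q b :: nat
  using div_mult_mod_eq[of q b] mod_less_divisor[OF that, of q] by linarith+

text \<open>A monotone function strictly increases from the start of a non-constant block to the start of any
  later block, so different non-constant blocks start with different values.\<close>

lemma card_nonconstant_blocks:
  fixes \<mu> :: "nat \<Rightarrow> nat"
  assumes b: "b > 0" and mono: "\<And>q q'. q \<le> q' \<Longrightarrow> q' < n * b \<Longrightarrow> \<mu> q \<le> \<mu> q'"
    and R: "\<And>q. q < n * b \<Longrightarrow> \<mu> q < R"
  shows "card {p. p < n \<and> (\<exists>q. q div b = p \<and> \<mu> q \<noteq> \<mu> (p * b))} \<le> R"
proof -
  let ?I = "{p. p < n \<and> (\<exists>q. q div b = p \<and> \<mu> q \<noteq> \<mu> (p * b))}"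
  have less: "\<mu> (p * b) < \<mu> (p' * b)" if "p \<in> ?I" "p < p'" "p' < n" for p p'
  proof -
    from \<open>p \<in> ?I\<close> obtain q where q: "q div b = p" "\<mu> q \<noteq> \<mu> (p * b)" by blast
    have "p * b \<le> q" using q(1) by auto
    have "q < (p + 1) * b" using q(1) block_bounds(2)[OF b, of q] by simp
    also have "\<dots> \<le> p' * b" using that(2) by (intro mult_le_mono1) simp
    finally have "q \<le> p' * b" by simp
    moreover have "p' * b < n * b" using that(3) b by simp
    ultimately show ?thesis using mono[of "p * b" q] mono[of q "p' * b"] \<open>p * b \<le> q\<close> q(2) by linarith
  qed
  have "inj_on (\<lambda>p. \<mu> (p * b)) ?I"
  proof (rule linorder_inj_onI)
    fix p p' assume "p < p'" "p \<in> ?I" "p' \<in> ?I"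
    then show "\<mu> (p * b) \<noteq> \<mu> (p' * b)" using less[of p p'] by simp
  qed auto
  moreover have "(\<lambda>p. \<mu> (p * b)) ` ?I \<subseteq> {..<R}" using R b by auto
  ultimately show ?thesis using card_inj_on_le[of _ ?I "{..<R}"] by simp
qed

lemma card_div_fibre: "card {q. q div b \<in> I} \<le> card I * b" if "finite I" "b > 0" for b :: nat
proof -
  have "{q. q div b \<in> I} \<subseteq> (\<Union>p\<in>I. {p * b..<p * b + b})"
  proof
    fix q assume "q \<in> {q. q div b \<in> I}"
    moreover have "q \<in> {q div b * b..<q div b * b + b}"
      using block_bounds[OF that(2), of q] by simp
    ultimately show "q \<in> (\<Union>p\<in>I. {p * b..<p * b + b})" by blast
  qed
  then have "card {q. q div b \<in> I} \<le> card (\<Union>p\<in>I. {p * b..<p * b + b})"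
    using that(1) by (intro card_mono) auto
  also have "\<dots> \<le> (\<Sum>p\<in>I. card {p * b..<p * b + b})" by (rule card_UN_le[OF that(1)])
  finally show ?thesis by simp
qed

lemma block_sum:
  fixes M :: "nat \<Rightarrow> nat \<Rightarrow> real" and g :: "nat \<Rightarrow> nat"
  assumes S: "finite S" "g ` S \<subseteq> {..<n}" and T: "finite T" "g ` T \<subseteq> {..<n}"
  shows "(\<Sum>i\<in>S. \<Sum>j\<in>T. M (g i) (g j))
    = (\<Sum>p<n. \<Sum>q<n. real (card {i\<in>S. g i = p}) * real (card {j\<in>T. g j = q}) * M p q)"
proof -
  have group: "(\<Sum>i\<in>A. f (g i)) = (\<Sum>p<n. real (card {i\<in>A. g i = p}) * f p)"
    if "finite A" "g ` A \<subseteq> {..<n}" for A and f :: "nat \<Rightarrow> real"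
  proof -
    have "(\<Sum>i\<in>A. f (g i)) = (\<Sum>p<n. \<Sum>i\<in>{i\<in>A. g i = p}. f (g i))"
      using that by (subst sum.group) auto
    also have "\<dots> = (\<Sum>p<n. real (card {i\<in>A. g i = p}) * f p)"
      by (intro sum.cong refl) simp
    finally show ?thesis .
  qed
  have "(\<Sum>i\<in>S. \<Sum>j\<in>T. M (g i) (g j)) = (\<Sum>i\<in>S. \<Sum>q<n. real (card {j\<in>T. g j = q}) * M (g i) q)"
    by (rule sum.cong[OF refl], rule group[OF T])
  also have "\<dots> = (\<Sum>p<n. real (card {i\<in>S. g i = p}) * (\<Sum>q<n. real (card {j\<in>T. g j = q}) * M p q))"
    by (rule group[OF S])
  finally show ?thesis by (simp add: sum_distrib_left mult.assoc)
qed

text \<open>The combinatorial core. Indices below \<open>N\<close> stand for cells, \<open>i div w\<close> is the strip of the cell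
  \<open>i\<close>, and \<open>pos i div b\<close> is the block, that is the vertex, to which it is sent. The three
  contributions to the error are \<open>\<eta>\<close> from regularity, \<open>2 / L\<close> from the blocks that meet several
  classes, and \<open>9 / L\<close> from the rounding.\<close>

lemma finite_order_approximation:
  fixes D :: "nat \<Rightarrow> nat \<Rightarrow> real" and \<eta> :: real and k L n b N w :: nat
  assumes D: "\<And>i j. i < N \<Longrightarrow> j < N \<Longrightarrow> 0 \<le> D i j \<and> D i j \<le> 1 \<and> D i j = D j i"
    and \<eta>: "\<eta> > 0" and k: "real k * \<eta>\<^sup>2 \<ge> 1"
    and L: "L \<ge> 1" and n: "n = (2 ^ k * L)\<^sup>2" and b: "b \<ge> 1" and N: "N = n * b" and w: "N = L * w"
  obtains pos :: "nat \<Rightarrow> nat" and G :: "nat \<Rightarrow> nat \<Rightarrow> nat"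
  where "bij_betw pos {..<N} {..<N}" "\<And>i. i < N \<Longrightarrow> pos i div w = i div w"
    "\<And>p q. G p q \<in> {0, 1}" "\<And>p q. G p q = G q p" "\<And>p. G p p = 0"
    "\<And>S T. S \<subseteq> {..<N} \<Longrightarrow> T \<subseteq> {..<N} \<Longrightarrow>
      \<bar>\<Sum>i\<in>S. \<Sum>j\<in>T. D i j - real (G (pos i div b) (pos j div b))\<bar> \<le> (\<eta> + 11 / L) * real N ^ 2"
proof (rule weak_regularity[of N D, OF D \<eta> k], assumption, assumption)
  fix l :: "nat \<Rightarrow> nat" and U
  assume l: "\<And>i. l i < (4 :: nat) ^ k" and U01: "\<And>i j. 0 \<le> U i j \<and> U i j \<le> 1"
    and Usym: "\<And>i j. U i j = U j i"
    and Ul: "\<And>i i' j j'. l i = l i' \<Longrightarrow> l j = l j' \<Longrightarrow> U i j = U i' j'"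
    and reg: "\<And>S T. S \<subseteq> {..<N} \<Longrightarrow> T \<subseteq> {..<N} \<Longrightarrow> \<bar>\<Sum>i\<in>S. \<Sum>j\<in>T. D i j - U i j\<bar> \<le> \<eta> * real N ^ 2"
  define K :: nat where "K = 4 ^ k"
  define r :: nat where "r = 2 ^ k * L"
  have r: "r \<ge> 1" "n = r\<^sup>2" using L n by (auto simp: r_def)
  have nK: "n = K * L * L"
  proof -
    have "(2 ^ k * 2 ^ k :: nat) = 4 ^ k" by (simp add: power_mult_distrib[symmetric])
    then show ?thesis by (simp add: n K_def power2_eq_square)
  qed
  have w0: "w > 0" using N w b r L by (cases w) auto
  \<comment> \<open>The strip is the leading digit and the class the trailing one. There are \<open>K * L\<close> keys, a fraction
    \<open>1 / L\<close> of the number \<open>n = K * L * L\<close> of blocks.\<close>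
  define key where "key i = (i div w) * K + l i" for i
  have key_div: "key i div K = i div w" and key_mod: "key i mod K = l i" for i
    using l[of i] by (simp_all add: key_def K_def)
  obtain \<pi> where \<pi>: "bij_betw \<pi> {..<N} {..<N}"
    and sorted: "\<And>q q'. q \<le> q' \<Longrightarrow> q' < N \<Longrightarrow> key (\<pi> q) \<le> key (\<pi> q')"
    by (rule sorting_permutation[of N key]) (rule that)
  have \<pi>N: "\<pi> q < N" if "q < N" for q using \<pi> that by (auto simp: bij_betw_def)
  have strip: "\<pi> q div w = q div w" if "q < N" for q
  proof (rule monotone_rearrangement_unique[OF \<pi> _ _ that])
    show "q div w \<le> q' div w" if "q \<le> q'" for q q' using that by (rule div_le_mono)
    show "\<pi> q div w \<le> \<pi> q' div w" if "q \<le> q'" "q' < N" for q q'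
      using div_le_mono[OF sorted[OF that], of K] by (simp add: key_div)
  qed
  define pos where "pos = inv_into {..<N} \<pi>"
  have pos: "bij_betw pos {..<N} {..<N}" unfolding pos_def by (rule bij_betw_inv_into[OF \<pi>])
  have posN: "pos i < N" if "i < N" for i using pos that by (auto simp: bij_betw_def)
  have \<pi>pos: "\<pi> (pos i) = i" if "i < N" for i
    using bij_betw_inv_into_right[OF \<pi>] that by (simp add: pos_def)
  have posstrip: "pos i div w = i div w" if "i < N" for i
    using strip[OF posN[OF that]] \<pi>pos[OF that] by simp
  have posdiv: "pos i div b < n" if "i < N" for i
    using posN[OF that] b N by (simp add: less_mult_imp_div_less)
  \<comment> \<open>The density between two blocks is read off at their first cells. In blocks that meet only
    one key this is the value of \<open>U\<close> at every cell.\<close>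
  define rep where "rep p = \<pi> (p * b)" for p
  define P where "P p q = U (rep p) (rep q)" for p q
  define I where "I = {p. p < n \<and> (\<exists>q. q div b = p \<and> key (\<pi> q) \<noteq> key (\<pi> (p * b)))}"
  have Ifin: "finite I" by (simp add: I_def)
  have cardI: "card I \<le> K * L"
    unfolding I_def
  proof (rule card_nonconstant_blocks)
    show "key (\<pi> q) < K * L" if "q < n * b" for q
    proof -
      have "key (\<pi> q) div K < L"
        using \<pi>N[of q] that N w by (simp add: key_div less_mult_imp_div_less)
      then show ?thesis by (simp add: K_def mult.commute div_less_iff_less_mult)
    qed
  qed (use sorted N b in auto)
  have pure: "U i j = P (pos i div b) (pos j div b)"
    if "i < N" "j < N" "pos i div b \<notin> I" "pos j div b \<notin> I" for i j
  proof -
    have lab: "l i = l (rep (pos i div b))" if "i < N" "pos i div b \<notin> I" for i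
    proof -
      have "key (\<pi> (pos i)) = key (rep (pos i div b))"
        using that(2) posdiv[OF that(1)] unfolding I_def rep_def by blast
      then have "key i = key (rep (pos i div b))" using \<pi>pos that by simp
      then show ?thesis using key_mod by metis
    qed
    show ?thesis unfolding P_def using that by (intro Ul lab) auto
  qed
  have P01: "0 \<le> P p q \<and> P p q \<le> 1" and Psym: "P p q = P q p" for p q
    using U01 Usym by (simp_all add: P_def)
  obtain G where G01: "\<And>p q. G p q \<in> {0, 1 :: nat}" and Gsym: "\<And>p q. G p q = G q p" and Gdiag: "\<And>p. G p p = 0"
    and G: "\<And>S T. S \<subseteq> {..<n} \<Longrightarrow> T \<subseteq> {..<n} \<Longrightarrow> \<bar>\<Sum>i\<in>S. \<Sum>j\<in>T. P i j - real (G i j)\<bar> \<le> 9 * real r * real n"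
    by (rule graph_rounding[of P r n, OF P01 Psym r]) (rule that)
  show thesis
  proof (rule that[OF pos posstrip G01 Gsym Gdiag])
    fix S T assume S: "S \<subseteq> {..<N}" and T: "T \<subseteq> {..<N}"
    have fin: "finite S" "finite T" using S T by (auto intro: finite_subset)
    let ?g = "\<lambda>i. pos i div b"
    have split: "(\<Sum>i\<in>S. \<Sum>j\<in>T. D i j - real (G (?g i) (?g j)))
      = (\<Sum>i\<in>S. \<Sum>j\<in>T. D i j - U i j) + (\<Sum>i\<in>S. \<Sum>j\<in>T. U i j - P (?g i) (?g j))
        + (\<Sum>i\<in>S. \<Sum>j\<in>T. P (?g i) (?g j) - real (G (?g i) (?g j)))"
      by (simp add: sum.distrib[symmetric])
    have "\<bar>\<Sum>i\<in>S. \<Sum>j\<in>T. U i j - P (?g i) (?g j)\<bar> \<le> 2 / L * real N ^ 2"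
    proof -
      let ?J = "{i. i < N \<and> ?g i \<in> I}"
      have "card ?J \<le> card {q. q div b \<in> I}"
      proof (rule card_inj_on_le)
        show "inj_on pos ?J" using pos by (auto simp: bij_betw_def inj_on_def)
        have "{q. q div b \<in> I} \<subseteq> {..<n * b}" using b by (auto simp: I_def div_less_iff_less_mult)
        then show "finite {q. q div b \<in> I}" by (rule finite_subset) simp
      qed auto
      also have "\<dots> \<le> card I * b" using Ifin b by (intro card_div_fibre) auto
      also have "\<dots> \<le> K * L * b" using cardI by simp
      finally have J: "real (card ?J) \<le> real (K * L * b)" by (rule of_nat_mono)
      have "\<bar>\<Sum>i\<in>S. \<Sum>j\<in>T. U i j - P (?g i) (?g j)\<bar> \<le> (\<Sum>i\<in>S. \<Sum>j\<in>T. \<bar>U i j - P (?g i) (?g j)\<bar>)"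
        by (rule order_trans[OF sum_abs], rule sum_mono, rule sum_abs)
      also have "\<dots> \<le> (\<Sum>i<N. \<Sum>j<N. \<bar>U i j - P (?g i) (?g j)\<bar>)"
        using S T by (intro order_trans[OF sum_mono sum_mono2] sum_mono2) (auto intro!: sum_nonneg)
      also have "\<dots> \<le> (\<Sum>i<N. \<Sum>j<N. of_bool (?g i \<in> I) + of_bool (?g j \<in> I))"
      proof (intro sum_mono)
        fix i j assume ij: "i \<in> {..<N}" "j \<in> {..<N}"
        have "\<bar>U i j - P (?g i) (?g j)\<bar> \<le> 1" using U01[of i j] P01[of "?g i" "?g j"] by (auto simp: abs_le_iff)
        then show "\<bar>U i j - P (?g i) (?g j)\<bar> \<le> of_bool (?g i \<in> I) + of_bool (?g j \<in> I)"
          using pure[of i j] ij by (auto simp: of_bool_def)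
      qed
      also have "\<dots> = 2 * real N * (\<Sum>i<N. of_bool (?g i \<in> I))"
        by (simp add: sum.distrib sum_distrib_left[symmetric])
      also have "(\<Sum>i<N. of_bool (?g i \<in> I)) = real (card ?J)"
        by (simp add: of_bool_def sum.If_cases lessThan_def Collect_conj_eq[symmetric])
      also have "2 * real N * real (card ?J) \<le> 2 * real N * real (K * L * b)"
        using J by (intro mult_left_mono) auto
      also have "\<dots> = 2 / L * real N ^ 2"
        using L by (simp add: N nK power2_eq_square field_simps)
      finally show ?thesis .
    qed
    moreover have "\<bar>\<Sum>i\<in>S. \<Sum>j\<in>T. P (?g i) (?g j) - real (G (?g i) (?g j))\<bar> \<le> 9 / L * real N ^ 2"
    proof -
      have sub: "?g ` S \<subseteq> {..<n}" "?g ` T \<subseteq> {..<n}" using S T posdiv by auto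
      have fibre: "real (card {i\<in>A. ?g i = p}) \<le> real b" if "A \<subseteq> {..<N}" for A p
      proof -
        have "card {i\<in>A. ?g i = p} \<le> card {q. q div b \<in> {p}}"
        proof (rule card_inj_on_le)
          show "inj_on pos {i\<in>A. ?g i = p}" using pos that by (auto simp: bij_betw_def inj_on_def subset_iff)
          have "{q. q div b \<in> {p}} \<subseteq> {..<p * b + b}" using b block_bounds(2)[of b] by auto
          then show "finite {q. q div b \<in> {p}}" by (rule finite_subset) simp
        qed auto
        also have "\<dots> \<le> card {p} * b" using b by (intro card_div_fibre) auto
        finally show ?thesis by simp
      qed
      have "\<bar>\<Sum>i\<in>S. \<Sum>j\<in>T. P (?g i) (?g j) - real (G (?g i) (?g j))\<bar> \<le> (real b)\<^sup>2 * (9 * real r * real n)"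
        unfolding block_sum[OF fin(1) sub(1) fin(2) sub(2), of "\<lambda>p q. P p q - real (G p q)"]
        by (rule bilinear_form_rounding) (use fibre[OF S] fibre[OF T] G in auto)
      also have "\<dots> \<le> 9 / L * real N ^ 2"
      proof -
        have "L \<le> r" by (simp add: r_def)
        then have "real L \<le> real r" by (rule of_nat_mono)
        then have "(real b)\<^sup>2 * (9 * real r * real n) * L \<le> (real b)\<^sup>2 * (9 * real r * real n) * r"
          by (intro mult_left_mono) auto
        also have "\<dots> = 9 * real N ^ 2" by (simp add: N r(2) power2_eq_square)
        finally show ?thesis using L by (simp add: field_simps)
      qed
      finally show ?thesis .
    qed
    ultimately show "\<bar>\<Sum>i\<in>S. \<Sum>j\<in>T. D i j - real (G (?g i) (?g j))\<bar> \<le> (\<eta> + 11 / L) * real N ^ 2"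
      using reg[OF S T] unfolding split by (simp add: algebra_simps)
  qed
qed

section \<open>Piecewise affine measure-preserving bijections\<close>

lemma emeasure_lborel_Times:
  fixes A :: "'a::euclidean_space set" and B :: "'b::euclidean_space set"
  assumes "A \<in> sets borel" "B \<in> sets borel"
  shows "emeasure lborel (A \<times> B) = emeasure lborel A * emeasure lborel B"
  using lborel.emeasure_pair_measure_Times[of A lborel B] assms by (simp add: lborel_prod)

text \<open>Lebesgue measure on a product is the completion of the Borel product measure, for which a rectangle
  with Lebesgue measurable sides need not be measurable. Enclosing each factor
  between Borel sets of the same measure encloses the product in the same way.\<close>

lemma lebesgue_Times:
  fixes S :: "'a::euclidean_space set" and T :: "'b::euclidean_space set"
  assumes S: "S \<in> lmeasurable" and T: "T \<in> lmeasurable"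
  shows "S \<times> T \<in> lmeasurable" and "measure lebesgue (S \<times> T) = measure lebesgue S * measure lebesgue T"
proof -
  have borel_hull: "\<exists>A B. A \<in> sets borel \<and> B \<in> sets borel \<and> A \<subseteq> X \<and> X \<subseteq> B \<and>
      emeasure lborel A = emeasure lebesgue X \<and> emeasure lborel B = emeasure lebesgue X"
    if "X \<in> sets lebesgue" for X :: "'c::euclidean_space set"
  proof -
    from that obtain A N N' where AN: "X = A \<union> N" "N \<subseteq> N'" "N' \<in> null_sets lborel" "A \<in> sets lborel"
      by (rule sets_completionE)
    have "emeasure lborel (A \<union> N') = emeasure lborel A"
      using AN by (intro emeasure_Un_null_set) auto
    moreover have "emeasure lebesgue X = emeasure lborel A"
      using AN by (simp add: emeasure_Un_null_set null_sets_completionI null_sets_completion_subset)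
    ultimately show ?thesis using AN by (intro exI[of _ A] exI[of _ "A \<union> N'"]) auto
  qed
  obtain A A' where A: "A \<in> sets borel" "A' \<in> sets borel" "A \<subseteq> S" "S \<subseteq> A'"
      "emeasure lborel A = emeasure lebesgue S" "emeasure lborel A' = emeasure lebesgue S"
    using borel_hull[of S] S by (auto simp: fmeasurable_def)
  obtain B B' where B: "B \<in> sets borel" "B' \<in> sets borel" "B \<subseteq> T" "T \<subseteq> B'"
      "emeasure lborel B = emeasure lebesgue T" "emeasure lborel B' = emeasure lebesgue T"
    using borel_hull[of T] T by (auto simp: fmeasurable_def)
  have AB: "A \<times> B \<in> sets borel" "A' \<times> B' \<in> sets borel"
    using A B by (auto intro: pair_measureI simp flip: borel_prod)
  have em: "emeasure lebesgue (A \<times> B) = emeasure lebesgue S * emeasure lebesgue T"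
    "emeasure lebesgue (A' \<times> B') = emeasure lebesgue S * emeasure lebesgue T"
    using A B AB by (simp_all add: emeasure_lborel_Times)
  have fin: "emeasure lebesgue S * emeasure lebesgue T < \<infinity>"
    using S T by (simp add: fmeasurable_def ennreal_mult_less_top del: emeasure_completion)
  have sets: "S \<times> T \<in> sets lebesgue"
  proof (rule completion.complete_sets_sandwich)
    show "A \<times> B \<in> sets lebesgue" "A' \<times> B' \<in> sets lebesgue" using AB by auto
    show "A \<times> B \<subseteq> S \<times> T" "S \<times> T \<subseteq> A' \<times> B'" using A B by auto
    show "emeasure lebesgue (A \<times> B) = emeasure lebesgue (A' \<times> B')" "emeasure lebesgue (A \<times> B) < \<infinity>"
      using em fin by simp_all
  qed
  have "emeasure lebesgue (S \<times> T) = emeasure lebesgue S * emeasure lebesgue T"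
  proof (rule antisym)
    show "emeasure lebesgue (S \<times> T) \<le> emeasure lebesgue S * emeasure lebesgue T"
      unfolding em(2)[symmetric] using A B AB by (intro emeasure_mono) auto
    show "emeasure lebesgue S * emeasure lebesgue T \<le> emeasure lebesgue (S \<times> T)"
      unfolding em(1)[symmetric] using A B sets by (intro emeasure_mono) auto
  qed
  then show "S \<times> T \<in> lmeasurable" "measure lebesgue (S \<times> T) = measure lebesgue S * measure lebesgue T"
    using sets fin by (simp_all add: fmeasurable_def measure_def enn2real_mult)
qed

lemma lebesgue_diagonal_affine:
  fixes \<alpha> \<beta> \<gamma> \<delta> :: real
  assumes "\<alpha> * \<gamma> = 1"
  defines "T \<equiv> (\<lambda>u :: real \<times> real. (\<alpha> * fst u + \<beta>, \<gamma> * snd u + \<delta>))"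
  shows "T \<in> lebesgue \<rightarrow>\<^sub>M lebesgue"
    and "A \<in> sets lebesgue \<Longrightarrow> emeasure lebesgue (T -` A) = emeasure lebesgue A"
proof -
  define c where "c j = (if j = (1, 0) then \<alpha> else \<gamma>)" for j :: "real \<times> real"
  have B: "Basis = {(1, 0), (0, 1) :: real \<times> real}" by (auto simp: Basis_prod_def)
  have T: "T = (\<lambda>u. (\<beta>, \<delta>) + (\<Sum>j\<in>Basis. (c j * (u \<bullet> j)) *\<^sub>R j))"
    by (rule ext) (auto simp: T_def B c_def inner_prod_def algebra_simps)
  have c: "c j \<noteq> 0" if "j \<in> Basis" for j using assms(1) by (auto simp: c_def)
  show meas: "T \<in> lebesgue \<rightarrow>\<^sub>M lebesgue"
    unfolding T by (rule lebesgue_affine_measurable[OF c])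
  have "(\<Prod>j\<in>Basis. \<bar>c j\<bar>) = 1"
    using assms(1) by (simp add: B c_def abs_mult[symmetric])
  then have "lebesgue = density (distr lebesgue lebesgue T) (\<lambda>_. 1)"
    using lebesgue_affine_euclidean[of c "(\<beta>, \<delta>)", OF c] unfolding T by simp
  then have eq: "lebesgue = distr lebesgue lebesgue T" by (simp add: density_1)
  assume "A \<in> sets lebesgue"
  then have "emeasure (distr lebesgue lebesgue T) A = emeasure lebesgue (T -` A)"
    using meas by (simp add: emeasure_distr)
  then show "emeasure lebesgue (T -` A) = emeasure lebesgue A" by (simp flip: eq)
qed

lemma piecewise_measure_preserving:
  fixes T :: "'i \<Rightarrow> 'a::euclidean_space \<Rightarrow> 'a"
  assumes C: "finite C" and P: "\<And>c. c \<in> C \<Longrightarrow> P c \<in> sets lebesgue" and R: "\<And>c. c \<in> C \<Longrightarrow> R c \<in> sets lebesgue"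
    and disj: "disjoint_family_on P C" "disjoint_family_on R C"
    and cover: "(\<Union>c\<in>C. P c) = X" "(\<Union>c\<in>C. R c) = X"
    and meas: "\<And>c. c \<in> C \<Longrightarrow> T c \<in> lebesgue \<rightarrow>\<^sub>M lebesgue"
    and pres: "\<And>c A. c \<in> C \<Longrightarrow> A \<in> sets lebesgue \<Longrightarrow> emeasure lebesgue (T c -` A) = emeasure lebesgue A"
    and PR: "\<And>c u. c \<in> C \<Longrightarrow> T c u \<in> R c \<longleftrightarrow> u \<in> P c"
    and f: "\<And>c u. c \<in> C \<Longrightarrow> u \<in> P c \<Longrightarrow> f u = T c u"
  shows "measure_preserving (lebesgue_on X) (lebesgue_on X) f"
proof -
  have X: "X \<in> sets lebesgue"
    unfolding cover(1)[symmetric] using C P by (intro sets.finite_UN) auto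
  have vim: "f -` A \<inter> X = (\<Union>c\<in>C. T c -` (A \<inter> R c))" for A
  proof (intro set_eqI iffI)
    fix u assume "u \<in> f -` A \<inter> X"
    then obtain c where "c \<in> C" "u \<in> P c" "f u \<in> A" using cover(1) by auto
    then show "u \<in> (\<Union>c\<in>C. T c -` (A \<inter> R c))" using f PR by auto
  next
    fix u assume "u \<in> (\<Union>c\<in>C. T c -` (A \<inter> R c))"
    then obtain c where c: "c \<in> C" "T c u \<in> A" "T c u \<in> R c" by auto
    then have "u \<in> P c" using PR by simp
    then show "u \<in> f -` A \<inter> X" using c f cover(1) by auto
  qed
  have piece: "T c -` (A \<inter> R c) \<in> sets lebesgue" if "c \<in> C" "A \<in> sets lebesgue" for c A
    using measurable_sets[OF meas[OF that(1)], of "A \<inter> R c"] that R by auto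
  have main: "f -` A \<inter> X \<in> sets lebesgue \<and> emeasure lebesgue (f -` A \<inter> X) = emeasure lebesgue A"
    if A: "A \<in> sets lebesgue" "A \<subseteq> X" for A
  proof
    show "f -` A \<inter> X \<in> sets lebesgue"
      unfolding vim using C piece A by (intro sets.finite_UN) auto
    have "disjoint_family_on (\<lambda>c. T c -` (A \<inter> R c)) C"
      using disj(1) PR unfolding disjoint_family_on_def by fastforce
    then have "emeasure lebesgue (f -` A \<inter> X) = (\<Sum>c\<in>C. emeasure lebesgue (T c -` (A \<inter> R c)))"
      unfolding vim using C piece A by (intro sum_emeasure[symmetric]) auto
    also have "\<dots> = (\<Sum>c\<in>C. emeasure lebesgue (A \<inter> R c))"
      using R A by (intro sum.cong refl pres) auto
    also have "\<dots> = emeasure lebesgue (\<Union>c\<in>C. A \<inter> R c)"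
    proof (intro sum_emeasure)
      show "disjoint_family_on (\<lambda>c. A \<inter> R c) C" using disj(2) unfolding disjoint_family_on_def by blast
    qed (use C R A in auto)
    also have "(\<Union>c\<in>C. A \<inter> R c) = A" using A cover(2) by auto
    finally show "emeasure lebesgue (f -` A \<inter> X) = emeasure lebesgue A" .
  qed
  have setsX: "A \<in> sets (lebesgue_on X) \<longleftrightarrow> A \<in> sets lebesgue \<and> A \<subseteq> X" for A
    using X by (subst sets_restrict_space_iff) auto
  have emX: "emeasure (lebesgue_on X) A = emeasure lebesgue A" if "A \<subseteq> X" for A
    using X that by (subst emeasure_restrict_space) auto
  show ?thesis
    unfolding measure_preserving_def
  proof (intro conjI ballI measurableI)
    fix u assume "u \<in> space (lebesgue_on X)"
    then obtain c where "c \<in> C" "u \<in> P c" using cover(1) by auto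
    then show "f u \<in> space (lebesgue_on X)" using f PR[of c u] cover(2) by auto
  next
    fix A assume "A \<in> sets (lebesgue_on X)"
    then have A: "A \<in> sets lebesgue" "A \<subseteq> X" by (auto simp: setsX)
    show "f -` A \<inter> space (lebesgue_on X) \<in> sets (lebesgue_on X)"
      using main[OF A] by (simp add: setsX)
    show "emeasure (lebesgue_on X) (f -` A \<inter> space (lebesgue_on X)) = emeasure (lebesgue_on X) A"
      using main[OF A] A by (simp add: emX)
  qed
qed

text \<open>Affine maps with diagonal linear part of determinant \<open>1\<close> that carry the pieces \<open>P c\<close> of one partition of the
  square to the pieces \<open>R c\<close> of another glue to an element of \<open>mp_bijections\<close>. The inverse has the
  same form with the roles of the partitions exchanged, so one gluing lemma serves both directions.\<close>

lemma piecewise_affine_mp_bijection: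
  fixes \<alpha> \<beta> \<gamma> \<delta> :: "'i \<Rightarrow> real"
  assumes C: "finite C" and P: "\<And>c. c \<in> C \<Longrightarrow> P c \<in> sets lebesgue" and R: "\<And>c. c \<in> C \<Longrightarrow> R c \<in> sets lebesgue"
    and disj: "disjoint_family_on P C" "disjoint_family_on R C"
    and cover: "(\<Union>c\<in>C. P c) = unit_square" "(\<Union>c\<in>C. R c) = unit_square"
    and \<alpha>\<gamma>: "\<And>c. c \<in> C \<Longrightarrow> \<alpha> c * \<gamma> c = 1"
    and PR: "\<And>c u. c \<in> C \<Longrightarrow> (\<alpha> c * fst u + \<beta> c, \<gamma> c * snd u + \<delta> c) \<in> R c \<longleftrightarrow> u \<in> P c"
    and f: "\<And>c u. c \<in> C \<Longrightarrow> u \<in> P c \<Longrightarrow> f u = (\<alpha> c * fst u + \<beta> c, \<gamma> c * snd u + \<delta> c)"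
  shows "f \<in> mp_bijections"
proof -
  define T where "T c u = (\<alpha> c * fst u + \<beta> c, \<gamma> c * snd u + \<delta> c)" for c u
  define T' where "T' c u = (\<gamma> c * fst u + (- \<gamma> c * \<beta> c), \<alpha> c * snd u + (- \<alpha> c * \<delta> c))" for c u
  have T'T: "T' c (T c u) = u" and TT': "T c (T' c u) = u" if "c \<in> C" for c u
  proof -
    have 1: "\<gamma> c * (\<alpha> c * x + y) + - \<gamma> c * y = x" "\<alpha> c * (\<gamma> c * x + y) + - \<alpha> c * y = x"
      "\<alpha> c * (\<gamma> c * x + - \<gamma> c * y) + y = x" "\<gamma> c * (\<alpha> c * x + - \<alpha> c * y) + y = x" for x y
      using \<alpha>\<gamma>[OF that] by algebra+
    show "T' c (T c u) = u" "T c (T' c u) = u"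
      unfolding T_def T'_def fst_conv snd_conv 1 by simp_all
  qed
  have inj: "inj_on f unit_square"
  proof (rule inj_onI)
    fix u v assume "u \<in> unit_square" "v \<in> unit_square" and eq: "f u = f v"
    then obtain c d where c: "c \<in> C" "u \<in> P c" and d: "d \<in> C" "v \<in> P d" using cover(1) by (metis UN_E)
    have "f u \<in> R c" "f v \<in> R d" using f PR c d by auto
    then have "c = d" using eq disj(2) c d by (auto simp: disjoint_family_on_def)
    then show "u = v" using eq f c d T'T[OF c(1)] unfolding T_def by metis
  qed
  have inv: "T' c v \<in> P c \<and> T' c v \<in> unit_square \<and> f (T' c v) = v" if "c \<in> C" "v \<in> R c" for c v
  proof -
    have e: "T c (T' c v) = v" by (rule TT'[OF that(1)])
    then have P: "T' c v \<in> P c" using PR[OF that(1), of "T' c v"] that(2) unfolding T_def by metis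
    then have "f (T' c v) = v" using f[OF that(1) P] e unfolding T_def by metis
    moreover have "T' c v \<in> unit_square" unfolding cover(1)[symmetric] using that(1) P by (rule UN_I)
    ultimately show ?thesis using P by blast
  qed
  have bij: "bij_betw f unit_square unit_square"
    unfolding bij_betw_def
  proof (intro conjI inj equalityI subsetI)
    fix v assume "v \<in> f ` unit_square"
    then obtain u where u: "u \<in> unit_square" "v = f u" by blast
    then obtain c where "c \<in> C" "u \<in> P c" using cover(1) by (metis UN_E)
    then have "f u \<in> R c" "c \<in> C" using f PR by auto
    then show "v \<in> unit_square" using u cover(2) by blast
  next
    fix v assume "v \<in> unit_square"
    then obtain c where "c \<in> C" "v \<in> R c" using cover(2) by (metis UN_E)
    then show "v \<in> f ` unit_square" using inv[of c v] by (metis imageI)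
  qed
  have "measure_preserving (lebesgue_on unit_square) (lebesgue_on unit_square) f"
  proof (rule piecewise_measure_preserving[OF C P R disj cover, where T = T])
    show "T c \<in> lebesgue \<rightarrow>\<^sub>M lebesgue" if "c \<in> C" for c
      unfolding T_def by (rule lebesgue_diagonal_affine(1)[OF \<alpha>\<gamma>[OF that]])
    show "emeasure lebesgue (T c -` A) = emeasure lebesgue A" if "c \<in> C" "A \<in> sets lebesgue" for c A
      unfolding T_def by (rule lebesgue_diagonal_affine(2)[OF \<alpha>\<gamma>[OF that(1)] that(2)])
  qed (use PR f in \<open>auto simp: T_def\<close>)
  moreover have "measure_preserving (lebesgue_on unit_square) (lebesgue_on unit_square) (inv_into unit_square f)"
  proof (rule piecewise_measure_preserving[OF C R P disj(2,1) cover(2,1), where T = T'])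
    have \<gamma>\<alpha>: "\<gamma> c * \<alpha> c = 1" if "c \<in> C" for c using \<alpha>\<gamma>[OF that] by (simp add: mult.commute)
    show "T' c \<in> lebesgue \<rightarrow>\<^sub>M lebesgue" if "c \<in> C" for c
      unfolding T'_def by (rule lebesgue_diagonal_affine(1)[OF \<gamma>\<alpha>[OF that]])
    show "emeasure lebesgue (T' c -` A) = emeasure lebesgue A" if "c \<in> C" "A \<in> sets lebesgue" for c A
      unfolding T'_def by (rule lebesgue_diagonal_affine(2)[OF \<gamma>\<alpha>[OF that(1)] that(2)])
    show "T' c u \<in> P c \<longleftrightarrow> u \<in> R c" if "c \<in> C" for c u
      using PR[OF that, of "T' c u"] TT'[OF that, of u] unfolding T_def by metis
    show "inv_into unit_square f u = T' c u" if "c \<in> C" "u \<in> R c" for c u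
      using inv[OF that] inj by (metis inv_into_f_f)
  qed
  ultimately show ?thesis using bij by (simp add: mp_bijections_def)
qed

section \<open>Cells of the square and their rearrangement\<close>

text \<open>Bins are numbered from \<open>0\<close> and closed on the right, matching the ceiling in \<open>Q\<close>. They tile only
  the half-open interval \<open>{0<..1}\<close>; the points with a coordinate \<open>0\<close> form a null set that is treated
  separately throughout.\<close>

definition bin :: "nat \<Rightarrow> real \<Rightarrow> nat" where
  "bin n x = nat (\<lceil>real n * x\<rceil> - 1)"

lemma bin_eq_iff:
  assumes "n \<ge> 1" "0 < x"
  shows "bin n x = i \<longleftrightarrow> x \<in> {real i / n<..(real i + 1) / n}"
proof -
  have "\<lceil>real n * x\<rceil> \<ge> 1" using assms by (simp add: le_ceiling_iff)
  then have "bin n x = i \<longleftrightarrow> \<lceil>real n * x\<rceil> = int i + 1" by (auto simp: bin_def)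
  also have "\<dots> \<longleftrightarrow> real i < real n * x \<and> real n * x \<le> real i + 1" by (simp add: ceiling_eq_iff)
  also have "\<dots> \<longleftrightarrow> x \<in> {real i / n<..(real i + 1) / n}"
    using assms by (simp add: field_simps)
  finally show ?thesis .
qed

lemma bin_bounds: "n \<ge> 1 \<Longrightarrow> 0 < x \<Longrightarrow> real (bin n x) / n < x \<and> x \<le> (real (bin n x) + 1) / n"
  using bin_eq_iff[of n x "bin n x"] by simp

lemma bin_less:
  assumes "n \<ge> 1" "0 < x" "x \<le> 1"
  shows "bin n x < n"
proof -
  have "real (bin n x) < real n * x" using bin_bounds[OF assms(1,2)] assms by (simp add: field_simps)
  also have "\<dots> \<le> real n" using assms by (simp add: mult_left_le)
  finally show ?thesis by simp
qed

lemma bin_coarsen: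
  assumes L: "L \<ge> 1" and d: "d \<ge> 1" and x: "0 < x"
  shows "bin (L * d) x div d = bin L x"
proof -
  define i where "i = bin (L * d) x"
  have "L * d \<ge> 1" using L d by simp
  from bin_bounds[OF this x] have i: "real i < x * L * d" "x * L * d \<le> real i + 1"
    using L d by (simp_all add: i_def field_simps)
  have "i div d * d \<le> i" "i + 1 \<le> i div d * d + d"
    using div_mult_mod_eq[of i d] mod_less_divisor[of d i] d by linarith+
  then have "real (i div d) * d \<le> real i" "real i + 1 \<le> (real (i div d) + 1) * d"
    by (metis of_nat_le_iff of_nat_mult, metis (no_types, opaque_lifting) of_nat_1 of_nat_add of_nat_le_iff of_nat_mult distrib_right mult_1)
  then have "real (i div d) * d < x * L * d" "x * L * d \<le> (real (i div d) + 1) * d"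
    using i by linarith+
  then have "real (i div d) < x * L" "x * L \<le> real (i div d) + 1" using d by simp_all
  then have "bin L x = i div d" using L x by (simp add: bin_eq_iff field_simps)
  then show ?thesis by (simp add: i_def)
qed

lemma bin_eq_imp_close:
  assumes "n \<ge> 1" "0 < x" "0 < y" "bin n x = bin n y"
  shows "\<bar>x - y\<bar> \<le> 1 / n"
proof -
  have "(real (bin n x) + 1) / n = real (bin n x) / n + 1 / n" by (simp add: add_divide_distrib)
  then show ?thesis using bin_bounds[of n x] bin_bounds[of n y] assms by auto
qed

lemma Q_eq_bin: "n \<ge> 1 \<Longrightarrow> 0 < x \<Longrightarrow> Q n x = bin n x + 1"
proof -
  assume "n \<ge> 1" "0 < x"
  then have "\<lceil>real n * x\<rceil> \<ge> 1" by (simp add: le_ceiling_iff)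
  then have "nat \<lceil>real n * x\<rceil> = nat (\<lceil>real n * x\<rceil> - 1) + 1" by arith
  then show ?thesis using \<open>0 < x\<close> by (simp only: Q_def bin_def) simp
qed

abbreviation tiled_square :: "(real \<times> real) set" where
  "tiled_square \<equiv> {0<..1} \<times> {0<..1}"

definition cell_index :: "nat \<Rightarrow> real \<times> real \<Rightarrow> nat" where
  "cell_index m u = bin m (fst u) * m + bin m (snd u)"

definition cell :: "nat \<Rightarrow> nat \<Rightarrow> (real \<times> real) set" where
  "cell m c = {u \<in> tiled_square. cell_index m u = c}"

lemma cell_index_div_mod:
  assumes "m \<ge> 1" "u \<in> tiled_square"
  shows "cell_index m u div m = bin m (fst u)" "cell_index m u mod m = bin m (snd u)"
    "cell_index m u < m * m"
proof -
  have b: "bin m (fst u) < m" "bin m (snd u) < m" using assms by (auto intro!: bin_less)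
  then show "cell_index m u div m = bin m (fst u)" "cell_index m u mod m = bin m (snd u)"
    by (simp_all add: cell_index_def)
  have "cell_index m u < (bin m (fst u) + 1) * m" using b by (simp add: cell_index_def)
  also have "\<dots> \<le> m * m" using b by (intro mult_le_mono1) simp
  finally show "cell_index m u < m * m" .
qed

lemma interval_subset_unit:
  assumes "n \<ge> 1" "i < n"
  shows "{real i / n<..(real i + 1) / n} \<subseteq> {0<..1}"
proof -
  have "(real i + 1) / n \<le> 1" "0 \<le> real i / n" using assms by (simp_all add: field_simps)
  then show ?thesis unfolding subset_iff greaterThanAtMost_iff by linarith
qed

lemma cell_eq_box:
  assumes m: "m \<ge> 1" and c: "c < m * m"
  shows "cell m c = {real (c div m) / m<..(real (c div m) + 1) / m} \<times> {real (c mod m) / m<..(real (c mod m) + 1) / m}"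
    (is "_ = ?X \<times> ?Y")
proof -
  have lt: "c div m < m" "c mod m < m" using m c by (simp_all add: less_mult_imp_div_less)
  have sub: "?X \<times> ?Y \<subseteq> tiled_square"
    using interval_subset_unit[OF m lt(1)] interval_subset_unit[OF m lt(2)] by blast
  have "u \<in> cell m c \<longleftrightarrow> u \<in> ?X \<times> ?Y" if "u \<in> tiled_square" for u
  proof -
    have "cell_index m u = c \<longleftrightarrow> bin m (fst u) = c div m \<and> bin m (snd u) = c mod m"
      using cell_index_div_mod[OF m that] by (metis cell_index_def div_mult_mod_eq)
    then show ?thesis using that m bin_eq_iff[OF m, of "fst u"] bin_eq_iff[OF m, of "snd u"]
      by (auto simp: cell_def mem_Times_iff)
  qed
  then show ?thesis using sub unfolding cell_def by blast
qed

lemma strip_eq_box: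
  assumes n: "n \<ge> 1" and p: "p < n"
  shows "{u \<in> tiled_square. bin n (fst u) = p} = {real p / n<..(real p + 1) / n} \<times> {0<..1}"
    (is "_ = ?X \<times> ?Y")
proof (intro set_eqI)
  fix u :: "real \<times> real"
  have "fst u \<in> ?X \<Longrightarrow> 0 < fst u \<and> fst u \<le> 1" using interval_subset_unit[OF n p] by auto
  then show "u \<in> {u \<in> tiled_square. bin n (fst u) = p} \<longleftrightarrow> u \<in> ?X \<times> ?Y"
    using bin_eq_iff[OF n, of "fst u" p] by (auto simp: mem_Times_iff)
qed

lemma half_open_box_lmeasurable:
  fixes a b c d :: real
  shows "{a<..b} \<times> {c<..d} \<in> lmeasurable"
    and "a \<le> b \<Longrightarrow> c \<le> d \<Longrightarrow> measure lebesgue ({a<..b} \<times> {c<..d}) = (b - a) * (d - c)"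
proof -
  have I: "{a<..b} \<in> lmeasurable" for a b :: real
    by (cases "a \<le> b") (auto simp: fmeasurable_def)
  show "{a<..b} \<times> {c<..d} \<in> lmeasurable" by (rule lebesgue_Times(1)[OF I I])
  show "measure lebesgue ({a<..b} \<times> {c<..d}) = (b - a) * (d - c)" if "a \<le> b" "c \<le> d"
    using that by (simp add: lebesgue_Times(2)[OF I I])
qed

lemma unit_square_lmeasurable: "unit_square \<in> lmeasurable" "measure lebesgue unit_square = 1"
proof -
  have "{0..1 :: real} \<in> lmeasurable" "measure lebesgue {0..1 :: real} = 1" by simp_all
  then show "unit_square \<in> lmeasurable" "measure lebesgue unit_square = 1"
    by (simp_all add: lebesgue_Times)
qed

lemma cell_lmeasurable:
  assumes "m \<ge> 1" "c < m * m"
  shows "cell m c \<in> lmeasurable" "measure lebesgue (cell m c) = 1 / (real m * real m)"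
proof -
  show "cell m c \<in> lmeasurable" unfolding cell_eq_box[OF assms] by (rule half_open_box_lmeasurable)
  show "measure lebesgue (cell m c) = 1 / (real m * real m)"
    unfolding cell_eq_box[OF assms]
    by (subst half_open_box_lmeasurable(2)) (auto simp: divide_right_mono simp flip: diff_divide_distrib)
qed

text \<open>A cell, of size \<open>1/m \<times> 1/m\<close>, is squeezed horizontally and stretched vertically by the factor \<open>m\<close>.
  This turns it into a full vertical strip of width \<open>1/(m * m)\<close>, which is moved to position \<open>pos c\<close>.\<close>

definition cell_map :: "nat \<Rightarrow> (nat \<Rightarrow> nat) \<Rightarrow> real \<times> real \<Rightarrow> real \<times> real" where
  "cell_map m pos u = (if u \<in> tiled_square then let c = cell_index m u in
     (1 / real m * fst u + (real (pos c) - real (c div m)) / (real m * real m), real m * snd u + (- real (c mod m))) else u)"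

lemma cell_map_strip_iff:
  fixes m c p :: nat
  assumes m: "m \<ge> 1" and c: "c < m * m" and p: "p < m * m"
  shows "(1 / real m * fst u + (real p - real (c div m)) / (real m * real m), real m * snd u + (- real (c mod m)))
      \<in> {u \<in> tiled_square. bin (m * m) (fst u) = p} \<longleftrightarrow> u \<in> cell m c"
proof -
  have m': "real m > 0" using m by simp
  have "real p / (real m * real m) < 1 / real m * x + (real p - i) / (real m * real m) \<longleftrightarrow> i / real m < x"
    "1 / real m * x + (real p - i) / (real m * real m) \<le> (real p + 1) / (real m * real m) \<longleftrightarrow> x \<le> (i + 1) / real m"
    "0 < real m * y + (- i) \<longleftrightarrow> i / real m < y" "real m * y + (- i) \<le> 1 \<longleftrightarrow> y \<le> (i + 1) / real m" for x y i :: real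
  proof -
    have "1 / real m * x + (real p - i) / (real m * real m) = (real p + (real m * x - i)) / (real m * real m)"
      using m' by (simp add: field_simps)
    then show "real p / (real m * real m) < 1 / real m * x + (real p - i) / (real m * real m) \<longleftrightarrow> i / real m < x"
      "1 / real m * x + (real p - i) / (real m * real m) \<le> (real p + 1) / (real m * real m) \<longleftrightarrow> x \<le> (i + 1) / real m"
      using m' by (simp_all add: divide_less_cancel divide_le_cancel pos_divide_less_eq pos_le_divide_eq mult.commute[of x]) linarith+
    show "0 < real m * y + (- i) \<longleftrightarrow> i / real m < y" "real m * y + (- i) \<le> 1 \<longleftrightarrow> y \<le> (i + 1) / real m"
      using m' by (simp_all add: pos_divide_less_eq pos_le_divide_eq mult.commute[of y]) linarith+
  qed
  note * = this
  have mm: "m * m \<ge> 1" using m by simp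
  show ?thesis
    unfolding strip_eq_box[OF mm p] cell_eq_box[OF m c]
    by (simp only: mem_Times_iff fst_conv snd_conv greaterThanAtMost_iff of_nat_mult *)
qed

lemma cell_map_tiled:
  assumes m: "m \<ge> 1" and pos: "bij_betw pos {..<m * m} {..<m * m}" and u: "u \<in> tiled_square"
  shows "cell_map m pos u \<in> tiled_square \<and> bin (m * m) (fst (cell_map m pos u)) = pos (cell_index m u)"
proof -
  define c where "c = cell_index m u"
  have c: "c < m * m" unfolding c_def by (rule cell_index_div_mod(3)[OF m u])
  have p: "pos c < m * m" using pos c by (auto simp: bij_betw_def)
  have "cell_map m pos u \<in> {u \<in> tiled_square. bin (m * m) (fst u) = pos c}"
    using cell_map_strip_iff[OF m c p, of u] u by (simp add: cell_map_def Let_def cell_def flip: c_def)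
  then show ?thesis by (simp add: c_def)
qed

text \<open>The extra index \<open>m * m\<close> stands for the boundary piece on which the map is the identity.\<close>

lemma cell_map_mp_bijection:
  assumes m: "m \<ge> 1" and pos: "bij_betw pos {..<m * m} {..<m * m}"
  shows "cell_map m pos \<in> mp_bijections"
proof -
  let ?N = "m * m" and ?B = "unit_square - tiled_square"
  define P where "P c = (if c < ?N then cell m c else ?B)" for c
  define R where "R c = (if c < ?N then {u \<in> tiled_square. bin ?N (fst u) = pos c} else ?B)" for c
  have mm: "?N \<ge> 1" using m by simp
  have posN: "pos c < ?N" if "c < ?N" for c using pos that by (auto simp: bij_betw_def)
  have B: "?B \<in> sets lebesgue"
    by (intro sets.Diff fmeasurableD unit_square_lmeasurable(1) half_open_box_lmeasurable(1))
  have tsub: "tiled_square \<subseteq> unit_square" by auto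
  show ?thesis
  proof (rule piecewise_affine_mp_bijection[where C = "{..?N}" and P = P and R = R
        and \<alpha> = "\<lambda>c. if c < ?N then 1 / real m else 1"
        and \<beta> = "\<lambda>c. if c < ?N then (real (pos c) - real (c div m)) / (real m * real m) else 0"
        and \<gamma> = "\<lambda>c. if c < ?N then real m else 1"
        and \<delta> = "\<lambda>c. if c < ?N then - real (c mod m) else 0"])
    show "P c \<in> sets lebesgue" for c
      using B cell_lmeasurable[OF m] by (auto simp: P_def fmeasurableD)
    show "R c \<in> sets lebesgue" for c
      using B half_open_box_lmeasurable(1) strip_eq_box[OF mm posN] by (simp add: R_def fmeasurableD)
    show "disjoint_family_on P {..?N}"
      by (auto simp: disjoint_family_on_def P_def cell_def split: if_splits)
    show "disjoint_family_on R {..?N}"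
      using pos by (auto simp: disjoint_family_on_def R_def bij_betw_def inj_on_def split: if_splits)
    show "(\<Union>c\<in>{..?N}. P c) = unit_square"
    proof (intro equalityI subsetI)
      fix u assume "u \<in> unit_square"
      then show "u \<in> (\<Union>c\<in>{..?N}. P c)"
      proof (cases "u \<in> tiled_square")
        case True
        then show ?thesis using cell_index_div_mod(3)[OF m True]
          by (intro UN_I[of "cell_index m u"]) (simp_all add: P_def cell_def)
      next
        case False
        then show ?thesis using \<open>u \<in> unit_square\<close> by (intro UN_I[of ?N]) (simp_all add: P_def)
      qed
    qed (use tsub in \<open>auto simp: P_def cell_def split: if_splits\<close>)
    show "(\<Union>c\<in>{..?N}. R c) = unit_square"
    proof (intro equalityI subsetI)
      fix u assume "u \<in> unit_square"
      then show "u \<in> (\<Union>c\<in>{..?N}. R c)"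
      proof (cases "u \<in> tiled_square")
        case True
        then have "bin ?N (fst u) < ?N" using mm by (intro bin_less) auto
        then obtain c where "c < ?N" "pos c = bin ?N (fst u)"
          using pos unfolding bij_betw_def by (metis imageE lessThan_iff)
        then show ?thesis using True by (intro UN_I[of c]) (simp_all add: R_def)
      next
        case False
        then show ?thesis using \<open>u \<in> unit_square\<close> by (intro UN_I[of ?N]) (simp_all add: R_def)
      qed
    qed (use tsub in \<open>auto simp: R_def split: if_splits\<close>)
    fix c u
    show "((if c < ?N then 1 / real m else 1) * fst u + (if c < ?N then (real (pos c) - real (c div m)) / (real m * real m) else 0),
        (if c < ?N then real m else 1) * snd u + (if c < ?N then - real (c mod m) else 0)) \<in> R c \<longleftrightarrow> u \<in> P c"
      using cell_map_strip_iff[OF m _ posN] by (simp add: R_def P_def)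
    show "cell_map m pos u = ((if c < ?N then 1 / real m else 1) * fst u + (if c < ?N then (real (pos c) - real (c div m)) / (real m * real m) else 0),
        (if c < ?N then real m else 1) * snd u + (if c < ?N then - real (c mod m) else 0))" if "u \<in> P c"
      using that by (auto simp: P_def cell_def cell_map_def Let_def split: if_splits)
  qed (use m in auto)
qed

text \<open>With \<open>m = L * d\<close>, the cells of one of the \<open>L\<close> vertical strips of width \<open>1 / L\<close> are \<open>d\<close> columns of
  \<open>m\<close> consecutive numbers. The positions in this strip carry the same \<open>d * m\<close> numbers, so a \<open>pos\<close> that
  preserves quotients by \<open>d * m\<close> moves no point out of its strip.\<close>

lemma Shift_cell_map_le:
  fixes L d m :: nat
  assumes L: "L \<ge> 1" and d: "d \<ge> 1" and m: "m = L * d"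
    and pos: "bij_betw pos {..<m * m} {..<m * m}" and strip: "\<And>c. c < m * m \<Longrightarrow> pos c div (d * m) = c div (d * m)"
  shows "Shift (cell_map m pos) \<le> 1 / real L"
  unfolding Shift_def
proof (rule cSUP_least)
  fix u :: "real \<times> real" assume "u \<in> unit_square"
  have m1: "m \<ge> 1" using L d m by simp
  show "\<bar>fst u - fst (cell_map m pos u)\<bar> \<le> 1 / real L"
  proof (cases "u \<in> tiled_square")
    case True
    define v where "v = cell_map m pos u"
    have v: "v \<in> tiled_square" "bin (m * m) (fst v) = pos (cell_index m u)"
      using cell_map_tiled[OF m1 pos True] by (simp_all add: v_def)
    have "bin L (fst u) = bin (L * d) (fst u) div d" using True L d by (subst bin_coarsen) auto
    also have "\<dots> = cell_index m u div (d * m)"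
      using cell_index_div_mod(1)[OF m1 True] by (simp add: m mult.commute[of d] div_mult2_eq)
    also have "\<dots> = bin (L * (d * m)) (fst v) div (d * m)"
      using strip[OF cell_index_div_mod(3)[OF m1 True]] v(2) m by (simp add: mult.assoc)
    also have "\<dots> = bin L (fst v)" using v(1) L d m1 by (subst bin_coarsen) auto
    finally show ?thesis using True v(1) L unfolding v_def by (intro bin_eq_imp_close) auto
  qed (simp add: cell_map_def)
qed simp

section \<open>Step kernels and the cut norm\<close>

definition step_kernel :: "nat \<Rightarrow> (nat \<Rightarrow> nat \<Rightarrow> real) \<Rightarrow> (real \<times> real) \<times> (real \<times> real) \<Rightarrow> real" where
  "step_kernel m M p = (\<Sum>c<m * m. \<Sum>d<m * m. M c d * indicat_real (cell m c \<times> cell m d) p)"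

lemma step_kernel_value:
  assumes "m \<ge> 1" "u \<in> tiled_square" "v \<in> tiled_square"
  shows "step_kernel m M (u, v) = M (cell_index m u) (cell_index m v)"
proof -
  have "step_kernel m M (u, v)
    = (\<Sum>c<m * m. if c = cell_index m u then \<Sum>d<m * m. if d = cell_index m v then M c d else 0 else 0)"
    unfolding step_kernel_def
  proof (rule sum.cong[OF refl])
    fix c
    show "(\<Sum>d<m * m. M c d * indicat_real (cell m c \<times> cell m d) (u, v))
      = (if c = cell_index m u then \<Sum>d<m * m. if d = cell_index m v then M c d else 0 else 0)"
      using assms(2,3) by (cases "c = cell_index m u") (auto simp: cell_def indicator_def intro!: sum.cong)
  qed
  then show ?thesis using cell_index_div_mod(3) assms by simp
qed

lemma step_kernel_outside:
  "fst p \<notin> tiled_square \<or> snd p \<notin> tiled_square \<Longrightarrow> step_kernel m M p = 0"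
  unfolding step_kernel_def by (intro sum.neutral ballI) (auto simp: cell_def indicator_def)

lemma step_kernel_integrable:
  assumes "m \<ge> 1"
  shows "integrable lebesgue (step_kernel m M)"
proof -
  have "integrable lebesgue (indicat_real (cell m c \<times> cell m d))" if "c < m * m" "d < m * m" for c d
    using lebesgue_Times(1)[OF cell_lmeasurable(1)[OF assms that(1)] cell_lmeasurable(1)[OF assms that(2)]]
    by (simp add: lmeasurable_iff_integrable)
  then have "integrable lebesgue (\<lambda>p. \<Sum>c<m * m. \<Sum>d<m * m. M c d * indicat_real (cell m c \<times> cell m d) p)"
    by (intro Bochner_Integration.integrable_sum integrable_mult_right) auto
  then show ?thesis by (simp add: step_kernel_def[abs_def])
qed

lemma step_kernel_integral:
  assumes m: "m \<ge> 1" and S: "S \<in> lmeasurable" and T: "T \<in> lmeasurable"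
  shows "(LINT p:S \<times> T|lebesgue. step_kernel m M p)
    = (\<Sum>c<m * m. \<Sum>d<m * m. measure lebesgue (S \<inter> cell m c) * measure lebesgue (T \<inter> cell m d) * M c d)"
proof -
  have piece: "(S \<inter> cell m c) \<times> (T \<inter> cell m d) \<in> lmeasurable"
    "measure lebesgue ((S \<inter> cell m c) \<times> (T \<inter> cell m d)) = measure lebesgue (S \<inter> cell m c) * measure lebesgue (T \<inter> cell m d)"
    if "c < m * m" "d < m * m" for c d
    using S T cell_lmeasurable(1)[OF m] that by (intro lebesgue_Times fmeasurable.Int; simp)+
  have "(LINT p:S \<times> T|lebesgue. step_kernel m M p)
    = (\<integral>p. (\<Sum>c<m * m. \<Sum>d<m * m. M c d * indicat_real ((S \<inter> cell m c) \<times> (T \<inter> cell m d)) p) \<partial>lebesgue)"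
  proof -
    have "indicat_real ((S \<inter> X) \<times> (T \<inter> Y)) p = indicat_real (S \<times> T) p * indicat_real (X \<times> Y) p" for X Y p
      by (auto simp: indicator_def)
    then show ?thesis
      unfolding set_lebesgue_integral_def step_kernel_def
      by (simp only: real_scaleR_def sum_distrib_left mult.left_commute)
  qed
  also have "\<dots> = (\<Sum>c<m * m. \<Sum>d<m * m. M c d * measure lebesgue ((S \<inter> cell m c) \<times> (T \<inter> cell m d)))"
  proof -
    have int: "integrable lebesgue (indicat_real ((S \<inter> cell m c) \<times> (T \<inter> cell m d)))" if "c < m * m" "d < m * m" for c d
      using piece(1)[OF that] by (simp add: lmeasurable_iff_integrable)
    have "(\<integral>p. (\<Sum>c<m * m. \<Sum>d<m * m. M c d * indicat_real ((S \<inter> cell m c) \<times> (T \<inter> cell m d)) p) \<partial>lebesgue)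
      = (\<Sum>c<m * m. \<integral>p. (\<Sum>d<m * m. M c d * indicat_real ((S \<inter> cell m c) \<times> (T \<inter> cell m d)) p) \<partial>lebesgue)"
      by (intro Bochner_Integration.integral_sum Bochner_Integration.integrable_sum integrable_mult_right int) auto
    also have "\<dots> = (\<Sum>c<m * m. \<Sum>d<m * m. \<integral>p. M c d * indicat_real ((S \<inter> cell m c) \<times> (T \<inter> cell m d)) p \<partial>lebesgue)"
      by (intro sum.cong refl Bochner_Integration.integral_sum integrable_mult_right int) auto
    finally show ?thesis by simp
  qed
  also have "\<dots> = (\<Sum>c<m * m. \<Sum>d<m * m. measure lebesgue (S \<inter> cell m c) * measure lebesgue (T \<inter> cell m d) * M c d)"
    by (intro sum.cong refl) (simp add: piece(2))
  finally show ?thesis .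
qed

text \<open>The integral of a non-integrable function is \<open>0\<close>, so the bound holds for every bounded \<open>V\<close>. Hence
  cut norms of differences are suprema of bounded sets for every relabelling, and the infimum
  defining \<open>cut_shift_dist\<close> is bounded below.\<close>

lemma cut_integral_bound:
  fixes V :: "real \<times> real \<Rightarrow> real \<times> real \<Rightarrow> real"
  assumes S: "S \<in> sets lebesgue" "S \<subseteq> unit_square" and T: "T \<in> sets lebesgue" "T \<subseteq> unit_square"
    and V: "\<And>u v. u \<in> unit_square \<Longrightarrow> v \<in> unit_square \<Longrightarrow> \<bar>V u v\<bar> \<le> b" and b: "0 \<le> b"
  shows "\<bar>LINT p:S \<times> T|lebesgue. V (fst p) (snd p)\<bar> \<le> b"
proof (cases "integrable lebesgue (\<lambda>p. indicat_real (S \<times> T) p *\<^sub>R V (fst p) (snd p))")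
  case False
  then show ?thesis using b by (simp add: set_lebesgue_integral_def not_integrable_integral_eq)
next
  case True
  have fin: "S \<in> lmeasurable" "T \<in> lmeasurable"
    using S T unit_square_lmeasurable(1) by (auto intro: fmeasurableI2)
  have le1: "measure lebesgue S \<le> 1" "measure lebesgue T \<le> 1"
    using measure_mono_fmeasurable[OF S(2) S(1) unit_square_lmeasurable(1)]
      measure_mono_fmeasurable[OF T(2) T(1) unit_square_lmeasurable(1)] unit_square_lmeasurable(2) by auto
  note prod = lebesgue_Times[OF fin]
  have int: "integrable lebesgue (\<lambda>p. b * indicat_real (S \<times> T) p)"
    using prod(1) by (simp add: lmeasurable_iff_integrable)
  have "\<bar>LINT p:S \<times> T|lebesgue. V (fst p) (snd p)\<bar> \<le> (\<integral>p. \<bar>indicat_real (S \<times> T) p *\<^sub>R V (fst p) (snd p)\<bar> \<partial>lebesgue)"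
    unfolding set_lebesgue_integral_def by (rule integral_abs_bound)
  also have "\<dots> \<le> (\<integral>p. b * indicat_real (S \<times> T) p \<partial>lebesgue)"
  proof (rule integral_mono[OF integrable_abs[OF True] int])
    fix p
    show "\<bar>indicat_real (S \<times> T) p *\<^sub>R V (fst p) (snd p)\<bar> \<le> b * indicat_real (S \<times> T) p"
    proof (cases "p \<in> S \<times> T")
      case True
      then have "fst p \<in> unit_square" "snd p \<in> unit_square" using S(2) T(2) by (metis mem_Times_iff subsetD)+
      then show ?thesis using V True by simp
    qed simp
  qed
  also have "\<dots> = b * (measure lebesgue S * measure lebesgue T)"
    using prod by simp
  also have "\<dots> \<le> b * 1" using b le1 by (intro mult_left_mono mult_le_one) auto
  finally show ?thesis by simp
qed

lemma cut_norm_le: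
  assumes "\<And>S T. S \<in> sets lebesgue \<Longrightarrow> S \<subseteq> unit_square \<Longrightarrow> T \<in> sets lebesgue \<Longrightarrow> T \<subseteq> unit_square \<Longrightarrow>
    \<bar>LINT p:S \<times> T|lebesgue. V (fst p) (snd p)\<bar> \<le> b"
  shows "cut_norm V \<le> b"
  unfolding cut_norm_def by (rule cSUP_least) (use assms in auto)

lemma cut_norm_nonneg:
  assumes "\<And>u v. u \<in> unit_square \<Longrightarrow> v \<in> unit_square \<Longrightarrow> \<bar>V u v\<bar> \<le> b" and "0 \<le> b"
  shows "0 \<le> cut_norm V"
  unfolding cut_norm_def
proof (rule cSUP_upper2[of _ _ "({}, {})"])
  show "bdd_above ((\<lambda>(S, T). \<bar>LINT p:S \<times> T|lebesgue. V (fst p) (snd p)\<bar>) `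
      ({S \<in> sets lebesgue. S \<subseteq> unit_square} \<times> {T \<in> sets lebesgue. T \<subseteq> unit_square}))"
    by (rule bdd_aboveI2[where M = b]) (use cut_integral_bound assms in auto)
qed auto

lemma Shift_nonneg:
  assumes "f \<in> mp_bijections"
  shows "0 \<le> Shift f"
proof -
  have f: "f u \<in> unit_square" if "u \<in> unit_square" for u
    using assms that by (auto simp: mp_bijections_def bij_betw_def)
  show ?thesis
    unfolding Shift_def
  proof (rule cSUP_upper2[of _ _ "(0, 0)"])
    show "bdd_above ((\<lambda>u. \<bar>fst u - fst (f u)\<bar>) ` unit_square)"
    proof (rule bdd_aboveI2[where M = 1])
      fix u :: "real \<times> real" assume u: "u \<in> unit_square"
      show "\<bar>fst u - fst (f u)\<bar> \<le> 1" using u f[OF u] by (auto simp: mem_Times_iff abs_le_iff)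
    qed
  qed auto
qed

lemma cut_shift_dist_le:
  assumes f: "f \<in> mp_bijections"
    and W: "\<And>u v. u \<in> unit_square \<Longrightarrow> v \<in> unit_square \<Longrightarrow> W u v \<in> {0..1}"
    and U: "\<And>u v. u \<in> unit_square \<Longrightarrow> v \<in> unit_square \<Longrightarrow> U u v \<in> {0..1}"
  shows "cut_shift_dist W U \<le> Shift f + cut_norm (\<lambda>u v. W u v - relabel U f u v)"
  unfolding cut_shift_dist_def
proof (rule cINF_lower[OF _ f])
  show "bdd_below ((\<lambda>f. Shift f + cut_norm (\<lambda>u v. W u v - relabel U f u v)) ` mp_bijections)"
  proof (rule bdd_belowI2[where m = 0])
    fix g assume g: "g \<in> mp_bijections"
    have "g u \<in> unit_square" if "u \<in> unit_square" for u
      using g that by (auto simp: mp_bijections_def bij_betw_def)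
    then have "\<bar>W u v - relabel U g u v\<bar> \<le> 1" if "u \<in> unit_square" "v \<in> unit_square" for u v
      using W[OF that] U[of "g u" "g v"] that by (auto simp: relabel_def abs_le_iff)
    then show "0 \<le> Shift g + cut_norm (\<lambda>u v. W u v - relabel U g u v)"
      using Shift_nonneg[OF g] cut_norm_nonneg[of "\<lambda>u v. W u v - relabel U g u v" 1] by simp
  qed
qed

section \<open>Approximation of orderons by step kernels\<close>

lemma negligible_swap:
  fixes N :: "('a::euclidean_space \<times> 'a) set"
  assumes "negligible N"
  shows "negligible {p. (snd p, fst p) \<in> N}"
proof -
  have "negligible {p \<in> UNIV. (\<lambda>p. (snd p, fst p)) p \<in> N}"
  proof (rule negligible_differentiable_vimage[OF assms])
    show "inj (\<lambda>p :: 'a \<times> 'a. (snd p, fst p))" by (auto simp: inj_on_def)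
    show "((\<lambda>p. (snd p, fst p)) has_derivative (\<lambda>p. (snd p, fst p))) (at x within UNIV)" for x :: "'a \<times> 'a"
      by (auto intro!: derivative_eq_intros)
  qed
  then show ?thesis by simp
qed

definition zero_extension ::
    "(real \<times> real \<Rightarrow> real \<times> real \<Rightarrow> real) \<Rightarrow> (real \<times> real) \<times> (real \<times> real) \<Rightarrow> real" where
  "zero_extension W p = (if p \<in> unit_square \<times> unit_square then W (fst p) (snd p) else 0)"

text \<open>A Lebesgue measurable function is an almost everywhere limit of continuous functions. Symmetrising and
  clamping these keeps the limit, since \<open>W\<close> is symmetric with values in \<open>[0, 1]\<close>, and makes
  dominated convergence applicable.\<close>

lemma orderon_continuous_approx:
  assumes W: "orderon W" and \<delta>: "\<delta> > 0"
  defines "w \<equiv> zero_extension W"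
  obtains g :: "(real \<times> real) \<times> (real \<times> real) \<Rightarrow> real"
  where "continuous_on UNIV g" "\<And>p. 0 \<le> g p \<and> g p \<le> 1" "\<And>u v. g (u, v) = g (v, u)"
    "integrable lebesgue (\<lambda>p. \<bar>w p - indicat_real (unit_square \<times> unit_square) p * g p\<bar>)"
    "(\<integral>p. \<bar>w p - indicat_real (unit_square \<times> unit_square) p * g p\<bar> \<partial>lebesgue) < \<delta>"
proof -
  have w_eq: "w = (\<lambda>p. if p \<in> unit_square \<times> unit_square then W (fst p) (snd p) else 0)"
    by (simp add: w_def zero_extension_def fun_eq_iff)
  let ?X = "unit_square \<times> unit_square"
  have X: "?X \<in> lmeasurable" by (rule lebesgue_Times(1)[OF unit_square_lmeasurable(1) unit_square_lmeasurable(1)])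
  have Wm: "(\<lambda>p. W (fst p) (snd p)) \<in> borel_measurable (lebesgue_on ?X)"
    and W01: "\<And>u v. u \<in> unit_square \<Longrightarrow> v \<in> unit_square \<Longrightarrow> W u v \<in> {0..1} \<and> W u v = W v u"
    using W unfolding orderon_def by blast+
  have wm: "w \<in> borel_measurable lebesgue"
    unfolding w_eq using Wm X by (subst borel_measurable_if) auto
  from Wm have "(\<lambda>p. W (fst p) (snd p)) measurable_on ?X"
    using X by (subst measurable_on_iff_borel_measurable) auto
  then obtain N h where N: "negligible N" and h: "\<And>n. continuous_on UNIV (h n)"
    and lim: "\<And>p. p \<notin> N \<Longrightarrow> (\<lambda>n. h n p) \<longlonglongrightarrow> w p"
    unfolding measurable_on_def w_eq by blast
  define g where "g n p = clamp01 ((h n p + h n (snd p, fst p)) / 2)" for n p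
  have gc: "continuous_on UNIV (g n)" for n
  proof -
    have "continuous_on UNIV (\<lambda>p. h n (snd p, fst p))"
      by (rule continuous_on_compose2[OF h]) (auto intro!: continuous_intros)
    then show ?thesis
      unfolding g_def clamp01_def using h by (intro continuous_intros) auto
  qed
  have gm: "g n \<in> borel_measurable lebesgue" for n
  proof -
    have "g n \<in> borel_measurable lborel" using borel_measurable_continuous_onI[OF gc[of n]] by simp
    then show ?thesis by (rule measurable_completion)
  qed
  let ?f = "\<lambda>n p. \<bar>w p - indicat_real ?X p * g n p\<bar>"
  have glim: "(\<lambda>n. ?f n p) \<longlonglongrightarrow> 0" if "p \<notin> N" "(snd p, fst p) \<notin> N" for p
  proof (cases "p \<in> ?X")
    case True
    then have w: "w (snd p, fst p) = w p" "w p \<in> {0..1}"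
      using W01[of "fst p" "snd p"] by (auto simp: w_eq)
    have "(\<lambda>n. max 0 (min 1 ((h n p + h n (snd p, fst p)) / 2))) \<longlonglongrightarrow> max 0 (min 1 ((w p + w (snd p, fst p)) / 2))"
      using lim[OF that(1)] lim[OF that(2)] by (intro tendsto_intros) auto
    then have "(\<lambda>n. g n p) \<longlonglongrightarrow> w p" using w by (simp add: g_def clamp01_def)
    then have "(\<lambda>n. \<bar>w p - g n p\<bar>) \<longlonglongrightarrow> \<bar>w p - w p\<bar>" by (intro tendsto_intros)
    then show ?thesis using True by simp
  qed (simp add: w_eq)
  have intX: "integrable lebesgue (indicat_real ?X)" using X by (simp add: lmeasurable_iff_integrable)
  have fm: "?f n \<in> borel_measurable lebesgue" for n
    using wm gm X by (intro borel_measurable_abs borel_measurable_diff borel_measurable_times borel_measurable_indicator) auto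
  have bd: "\<bar>?f n p\<bar> \<le> indicat_real ?X p" for n p
  proof (cases "p \<in> ?X")
    case True
    then have "0 \<le> w p" "w p \<le> 1" using W01[of "fst p" "snd p"] by (auto simp: w_eq)
    moreover have "0 \<le> g n p" "g n p \<le> 1" by (simp_all add: g_def clamp01_range)
    ultimately show ?thesis using True by (simp add: abs_le_iff)
  qed (simp add: w_eq)
  have ae: "AE p in lebesgue. (\<lambda>n. ?f n p) \<longlonglongrightarrow> 0"
  proof -
    have "negligible (N \<union> {p. (snd p, fst p) \<in> N})" using N negligible_swap by (intro negligible_Un) auto
    then have "AE p in lebesgue. p \<notin> N \<union> {p. (snd p, fst p) \<in> N}"
      by (intro AE_not_in) (simp add: negligible_iff_null_sets)
    then show ?thesis by eventually_elim (use glim in auto)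
  qed
  have int: "integrable lebesgue (?f n)" for n
    by (rule Bochner_Integration.integrable_bound[OF intX fm]) (use bd in auto)
  have "(\<lambda>n. \<integral>p. ?f n p \<partial>lebesgue) \<longlonglongrightarrow> (\<integral>p. 0 \<partial>(lebesgue :: ((real \<times> real) \<times> (real \<times> real)) measure))"
    by (rule integral_dominated_convergence[where w = "indicat_real ?X"]) (use fm intX bd ae in auto)
  then have "(\<lambda>n. \<integral>p. ?f n p \<partial>lebesgue) \<longlonglongrightarrow> 0" by simp
  from order_tendstoD(2)[OF this \<delta>] obtain n where n: "(\<integral>p. ?f n p \<partial>lebesgue) < \<delta>"
    unfolding eventually_sequentially by blast
  show thesis
  proof (rule that[of "g n"])
    show "0 \<le> g n p \<and> g n p \<le> 1" for p by (simp add: g_def clamp01_range)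
    show "g n (u, v) = g n (v, u)" for u v by (simp add: g_def add.commute)
  qed (use gc int n in auto)
qed

lemma dist_cell_corner:
  assumes m: "m \<ge> 1" and u: "u \<in> tiled_square"
  defines "z \<equiv> ((real (cell_index m u div m) + 1) / m, (real (cell_index m u mod m) + 1) / m)"
  shows "dist u z \<le> 2 / m" "z \<in> unit_square"
proof -
  have near: "\<bar>x - (real (bin m x) + 1) / m\<bar> \<le> 1 / m \<and> 0 \<le> (real (bin m x) + 1) / m \<and> (real (bin m x) + 1) / m \<le> 1"
    if "0 < x" "x \<le> 1" for x
  proof -
    have "(real (bin m x) + 1) / m = real (bin m x) / m + 1 / m" by (simp add: add_divide_distrib)
    moreover have "(real (bin m x) + 1) / m \<le> 1" using bin_less[OF m that] m by simp
    ultimately show ?thesis using bin_bounds[OF m that(1)] by auto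
  qed
  have z: "z = ((real (bin m (fst u)) + 1) / m, (real (bin m (snd u)) + 1) / m)"
    using cell_index_div_mod[OF m u] by (simp add: z_def)
  note n = near[of "fst u"] near[of "snd u"]
  show "z \<in> unit_square" using n u by (auto simp: z)
  have "dist u z = norm (u - z)" by (simp add: dist_norm)
  also have "\<dots> \<le> \<bar>fst u - fst z\<bar> + \<bar>snd u - snd z\<bar>"
    using norm_Pair_le[of "fst u - fst z" "snd u - snd z"] by (metis fst_diff snd_diff prod.collapse real_norm_def)
  also have "\<dots> \<le> 1 / m + 1 / m" using n u by (intro add_mono) (auto simp: z)
  finally show "dist u z \<le> 2 / m" by simp
qed

lemma AE_tiled:
  "AE p in lebesgue. p \<in> unit_square \<times> unit_square \<longrightarrow> p \<in> tiled_square \<times> tiled_square"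
proof -
  let ?X = "unit_square \<times> unit_square" and ?Y = "tiled_square \<times> tiled_square"
  have X: "?X \<in> lmeasurable" "measure lebesgue ?X = 1"
    using lebesgue_Times[OF unit_square_lmeasurable(1) unit_square_lmeasurable(1)] unit_square_lmeasurable(2) by simp_all
  have t: "tiled_square \<in> lmeasurable" "measure lebesgue tiled_square = 1"
    using half_open_box_lmeasurable[of 0 1 0 1] by simp_all
  have Y: "?Y \<in> lmeasurable" "measure lebesgue ?Y = 1"
    using lebesgue_Times[OF t(1) t(1)] t(2) by simp_all
  have sub: "?Y \<subseteq> ?X" by (intro Sigma_mono) auto
  have "?X - ?Y \<in> lmeasurable" "measure lebesgue (?X - ?Y) = 0"
    using measurable_measure_Diff[of ?X lebesgue ?Y, OF X(1) fmeasurableD[OF Y(1)]] sub X Y by (auto intro: fmeasurable.Diff)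
  then have "?X - ?Y \<in> null_sets lebesgue"
    by (simp add: negligible_iff_measure flip: negligible_iff_null_sets)
  then have "AE p in lebesgue. p \<notin> ?X - ?Y" by (rule AE_not_in)
  then show ?thesis by eventually_elim auto
qed

text \<open>By uniform continuity the continuous approximation may be sampled at one corner of each cell. Every
  sufficiently fine grid works, which leaves the freedom to choose \<open>m\<close> with prescribed divisors.\<close>

lemma orderon_step_approx:
  assumes W: "orderon W" and \<delta>: "\<delta> > 0"
  defines "w \<equiv> zero_extension W"
  obtains m0 :: nat where "m0 \<ge> 1" "\<And>m. m \<ge> m0 \<Longrightarrow> \<exists>D. (\<forall>c d. 0 \<le> D c d \<and> D c d \<le> 1 \<and> D c d = D d c) \<and>
    integrable lebesgue (\<lambda>p. w p - step_kernel m D p) \<and> (\<integral>p. \<bar>w p - step_kernel m D p\<bar> \<partial>lebesgue) \<le> \<delta>"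
proof -
  have w_eq: "w = (\<lambda>p. if p \<in> unit_square \<times> unit_square then W (fst p) (snd p) else 0)"
    by (simp add: w_def zero_extension_def fun_eq_iff)
  let ?X = "unit_square \<times> unit_square"
  have X: "?X \<in> lmeasurable" "measure lebesgue ?X = 1"
    using lebesgue_Times[OF unit_square_lmeasurable(1) unit_square_lmeasurable(1)] unit_square_lmeasurable(2) by simp_all
  have wint: "integrable lebesgue w"
  proof (rule Bochner_Integration.integrable_bound)
    show "integrable lebesgue (indicat_real ?X)" using X by (simp add: lmeasurable_iff_integrable)
    show "w \<in> borel_measurable lebesgue"
      unfolding w_eq using W X by (subst borel_measurable_if) (auto simp: orderon_def)
    show "AE p in lebesgue. norm (w p) \<le> norm (indicat_real ?X p)"
      using W by (auto simp: orderon_def w_eq indicator_def)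
  qed
  obtain g where g: "continuous_on UNIV g" and g01: "\<And>p. 0 \<le> g p \<and> g p \<le> 1" and gsym: "\<And>u v. g (u, v) = g (v, u)"
    and gint: "integrable lebesgue (\<lambda>p. \<bar>w p - indicat_real ?X p * g p\<bar>)"
    and gle: "(\<integral>p. \<bar>w p - indicat_real ?X p * g p\<bar> \<partial>lebesgue) < \<delta> / 2"
    using orderon_continuous_approx[OF W, of "\<delta> / 2"] \<delta> unfolding w_def by auto
  have "compact ?X" by (intro compact_Times compact_Icc)
  then have "uniformly_continuous_on ?X g"
    using g by (intro compact_uniformly_continuous) (auto intro: continuous_on_subset)
  then obtain r where r: "r > 0" and unif: "\<And>p q. p \<in> ?X \<Longrightarrow> q \<in> ?X \<Longrightarrow> dist q p < r \<Longrightarrow> dist (g q) (g p) < \<delta> / 2"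
    unfolding uniformly_continuous_on_def using \<delta> by (metis half_gt_zero)
  obtain m0 :: nat where m0: "real m0 > 4 / r" by (meson reals_Archimedean2)
  show thesis
  proof (rule that[of "max 1 m0"])
    fix m assume "m \<ge> max 1 m0"
    then have m: "m \<ge> 1" and "4 / r < real m" using m0 by auto
    then have mr: "4 / m < r" using r by (simp add: field_simps)
    define z where "z c = ((real (c div m) + 1) / m, (real (c mod m) + 1) / m)" for c
    define D where "D c d = g (z c, z d)" for c d
    have D: "0 \<le> D c d \<and> D c d \<le> 1 \<and> D c d = D d c" for c d
      using g01 gsym by (simp add: D_def)
    have int: "integrable lebesgue (\<lambda>p. w p - step_kernel m D p)"
      by (rule Bochner_Integration.integrable_diff[OF wint step_kernel_integrable[OF m]])
    have close: "\<bar>w p - step_kernel m D p\<bar> \<le> \<bar>w p - indicat_real ?X p * g p\<bar> + \<delta> / 2 * indicat_real ?X p"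
      if "p \<in> ?X \<longrightarrow> p \<in> tiled_square \<times> tiled_square" for p
    proof (cases "p \<in> ?X")
      case True
      obtain u v where p: "p = (u, v)" by (cases p)
      have uv: "u \<in> tiled_square" "v \<in> tiled_square" using that True p by auto
      note zu = dist_cell_corner[OF m uv(1), folded z_def] and zv = dist_cell_corner[OF m uv(2), folded z_def]
      have "dist (z (cell_index m u), z (cell_index m v)) p
        \<le> dist (z (cell_index m u)) u + dist (z (cell_index m v)) v"
        using norm_Pair_le[of "z (cell_index m u) - u" "z (cell_index m v) - v"] by (simp add: p dist_norm)
      also have "\<dots> \<le> 2 / m + 2 / m" using zu(1) zv(1) by (intro add_mono) (simp_all add: dist_commute)
      also have "\<dots> < r" using mr by simp
      finally have "dist (g (z (cell_index m u), z (cell_index m v))) (g p) < \<delta> / 2"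
        using True zu(2) zv(2) by (intro unif) auto
      then have "\<bar>step_kernel m D p - g p\<bar> < \<delta> / 2"
        by (simp add: p step_kernel_value[OF m uv] D_def dist_real_def)
      then have "\<bar>w p - step_kernel m D p\<bar> \<le> \<bar>w p - g p\<bar> + \<delta> / 2" by linarith
      then show ?thesis using True by simp
    next
      case False
      then have "step_kernel m D p = 0" by (intro step_kernel_outside) (auto simp: mem_Times_iff)
      then show ?thesis using False by (simp add: w_eq)
    qed
    have intX: "integrable lebesgue (\<lambda>p. \<delta> / 2 * indicat_real ?X p)"
      using X by (intro integrable_mult_right) (simp add: lmeasurable_iff_integrable)
    have "(\<integral>p. \<bar>w p - step_kernel m D p\<bar> \<partial>lebesgue)
      \<le> (\<integral>p. \<bar>w p - indicat_real ?X p * g p\<bar> + \<delta> / 2 * indicat_real ?X p \<partial>lebesgue)"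
    proof (rule integral_mono_AE)
      show "AE p in lebesgue. \<bar>w p - step_kernel m D p\<bar> \<le> \<bar>w p - indicat_real ?X p * g p\<bar> + \<delta> / 2 * indicat_real ?X p"
        using AE_tiled by eventually_elim (rule close)
    qed (use int gint intX in auto)
    also have "\<dots> = (\<integral>p. \<bar>w p - indicat_real ?X p * g p\<bar> \<partial>lebesgue) + \<delta> / 2 * measure lebesgue ?X"
      using gint intX by (subst Bochner_Integration.integral_add) auto
    also have "\<dots> \<le> \<delta>" using gle X by simp
    finally show "\<exists>D. (\<forall>c d. 0 \<le> D c d \<and> D c d \<le> 1 \<and> D c d = D d c) \<and>
      integrable lebesgue (\<lambda>p. w p - step_kernel m D p) \<and> (\<integral>p. \<bar>w p - step_kernel m D p\<bar> \<partial>lebesgue) \<le> \<delta>"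
      using D int by blast
  qed simp
qed

section \<open>Approximation of orderons by graphs\<close>

lemma graph_orderon_range:
  assumes "simple_ordered_graph n G" "u \<in> unit_square" "v \<in> unit_square"
  shows "graph_orderon n G u v \<in> {0..1}"
proof -
  have n: "n \<ge> 1" using assms(1) by (simp add: simple_ordered_graph_def)
  have Q: "Q n x \<in> {1..n}" if "x \<in> {0..1}" for x
  proof (cases "x = 0")
    case False
    then show ?thesis using that n bin_less[of n x] Q_eq_bin[of n x] by auto
  qed (use n in \<open>simp add: Q_def\<close>)
  have "G (Q n (fst u)) (Q n (fst v)) \<in> {0, 1}"
    using assms Q[of "fst u"] Q[of "fst v"] unfolding simple_ordered_graph_def by (auto simp: mem_Times_iff)
  then show ?thesis by (auto simp: graph_orderon_def)
qed

text \<open>The cut integral of a step kernel is the bilinear form of its matrix evaluated at the measures of the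
  intersections of \<open>S\<close> and \<open>T\<close> with the cells, which lie between \<open>0\<close> and \<open>1 / (m * m)\<close>.\<close>

lemma step_kernel_cut_bound:
  fixes M :: "nat \<Rightarrow> nat \<Rightarrow> real"
  assumes m: "m \<ge> 1" and S: "S \<in> sets lebesgue" "S \<subseteq> unit_square" and T: "T \<in> sets lebesgue" "T \<subseteq> unit_square"
    and M: "\<And>A B. A \<subseteq> {..<m * m} \<Longrightarrow> B \<subseteq> {..<m * m} \<Longrightarrow> \<bar>\<Sum>c\<in>A. \<Sum>d\<in>B. M c d\<bar> \<le> \<kappa> * real (m * m) ^ 2"
  shows "\<bar>LINT p:S \<times> T|lebesgue. step_kernel m M p\<bar> \<le> \<kappa>"
proof -
  have fin: "S \<in> lmeasurable" "T \<in> lmeasurable"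
    using S T unit_square_lmeasurable(1) by (auto intro: fmeasurableI2)
  let ?\<beta> = "1 / real (m * m)"
  have small: "0 \<le> measure lebesgue (A \<inter> cell m c) \<and> measure lebesgue (A \<inter> cell m c) \<le> ?\<beta>"
    if "A \<in> sets lebesgue" "c \<in> {..<m * m}" for A c
  proof -
    have c: "cell m c \<in> lmeasurable" "measure lebesgue (cell m c) = ?\<beta>" using cell_lmeasurable[OF m] that by auto
    have "measure lebesgue (A \<inter> cell m c) \<le> measure lebesgue (cell m c)"
      using c(1) that(1) by (intro measure_mono_fmeasurable) (auto simp: fmeasurableD)
    then show ?thesis using c(2) by simp
  qed
  have "\<bar>LINT p:S \<times> T|lebesgue. step_kernel m M p\<bar> \<le> ?\<beta>\<^sup>2 * (\<kappa> * real (m * m) ^ 2)"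
    unfolding step_kernel_integral[OF m fin]
    by (rule bilinear_form_rounding) (use small S T M in auto)
  also have "\<dots> = \<kappa>" using m by (simp add: power2_eq_square)
  finally show ?thesis .
qed

text \<open>Outside a null set the difference between \<open>W\<close> and the relabelled graph orderon splits into a step
  kernel, controlled by \<open>finite_order_approximation\<close>, and the \<open>L1\<close> error of
  \<open>orderon_step_approx\<close>. The shift contributes the twelfth \<open>1 / L\<close>.\<close>

lemma orderon_graph_approx:
  fixes k L :: nat and \<eta> \<delta> :: real
  assumes W: "orderon W" and \<eta>: "\<eta> > 0" and k: "real k * \<eta>\<^sup>2 \<ge> 1" and L: "L \<ge> 1" and \<delta>: "\<delta> > 0"
  obtains G where "simple_ordered_graph ((2 ^ k * L)\<^sup>2) G"
    "cut_shift_dist W (graph_orderon ((2 ^ k * L)\<^sup>2) G) \<le> \<eta> + 12 / real L + \<delta>"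
proof -
  define n :: nat where "n = (2 ^ k * L)\<^sup>2"
  define w where "w = zero_extension W"
  obtain t :: nat where t: "t \<ge> 1" and approx: "\<And>m. m \<ge> t \<Longrightarrow> \<exists>D. (\<forall>c d. 0 \<le> D c d \<and> D c d \<le> 1 \<and> D c d = D d c) \<and>
    integrable lebesgue (\<lambda>p. w p - step_kernel m D p) \<and> (\<integral>p. \<bar>w p - step_kernel m D p\<bar> \<partial>lebesgue) \<le> \<delta>"
    by (rule orderon_step_approx[OF W \<delta>, folded w_def]) (rule that)
  \<comment> \<open>Here \<open>m = L * 2 ^ k * t\<close>, so the \<open>m * m\<close> cells split into \<open>n\<close> blocks of \<open>t * t\<close> cells as well as
    into \<open>L\<close> strips of \<open>d\<close> columns each.\<close>
  define d where "d = 2 ^ k * t"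
  define m where "m = L * d"
  define b where "b = t * t"
  have d1: "d \<ge> 1" and m1: "m \<ge> 1" and b1: "b \<ge> 1" and n1: "n \<ge> 1"
    using t L by (simp_all add: d_def m_def b_def n_def)
  have N: "m * m = n * b" "m * m = L * (d * m)"
    by (simp_all add: m_def d_def n_def b_def power2_eq_square ac_simps)
  have "t \<le> 2 ^ k * t" by simp
  also have "\<dots> \<le> m" using L by (simp add: m_def d_def)
  finally have mt: "t \<le> m" .
  obtain D where D: "\<And>c d. 0 \<le> D c d \<and> D c d \<le> 1 \<and> D c d = D d c"
    and Eint: "integrable lebesgue (\<lambda>p. w p - step_kernel m D p)"
    and Ele: "(\<integral>p. \<bar>w p - step_kernel m D p\<bar> \<partial>lebesgue) \<le> \<delta>"
    using approx[OF mt] by blast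
  show thesis
  proof (rule finite_order_approximation[of "m * m" D \<eta> k L n b "d * m", OF D \<eta> k L n_def b1 N])
    fix pos :: "nat \<Rightarrow> nat" and H :: "nat \<Rightarrow> nat \<Rightarrow> nat"
    assume pos: "bij_betw pos {..<m * m} {..<m * m}" and strip: "\<And>c. c < m * m \<Longrightarrow> pos c div (d * m) = c div (d * m)"
      and H: "\<And>p q. H p q \<in> {0, 1}" "\<And>p q. H p q = H q p" "\<And>p. H p p = 0"
      and cut: "\<And>S T. S \<subseteq> {..<m * m} \<Longrightarrow> T \<subseteq> {..<m * m} \<Longrightarrow>
        \<bar>\<Sum>i\<in>S. \<Sum>j\<in>T. D i j - real (H (pos i div b) (pos j div b))\<bar> \<le> (\<eta> + 11 / real L) * real (m * m) ^ 2"
    define G where "G i j = H (i - 1) (j - 1)" for i j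
    define f where "f = cell_map m pos"
    define M where "M c e = D c e - real (H (pos c div b) (pos e div b))" for c e
    define V where "V u v = W u v - relabel (graph_orderon n G) f u v" for u v
    have G: "simple_ordered_graph n G"
      using n1 H(1) H(2) H(3) unfolding simple_ordered_graph_def G_def by blast
    have f: "f \<in> mp_bijections" unfolding f_def by (rule cell_map_mp_bijection[OF m1 pos])
    have Shift: "Shift f \<le> 1 / real L"
      unfolding f_def by (rule Shift_cell_map_le[OF L d1 m_def pos strip])
    have vertex: "Q n (fst (f u)) = pos (cell_index m u) div b + 1" if "u \<in> tiled_square" for u
    proof -
      have fu: "f u \<in> tiled_square" "bin (n * b) (fst (f u)) = pos (cell_index m u)"
        using cell_map_tiled[OF m1 pos that] by (simp_all add: f_def N(1))
      then have "bin n (fst (f u)) = pos (cell_index m u) div b"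
        using bin_coarsen[OF n1 b1, of "fst (f u)"] by auto
      then show ?thesis using Q_eq_bin[OF n1, of "fst (f u)"] fu(1) by auto
    qed
    have V: "V (fst p) (snd p) = step_kernel m M p + (w p - step_kernel m D p)"
      if "p \<in> tiled_square \<times> tiled_square" for p
    proof -
      obtain u v where p: "p = (u, v)" by (cases p)
      have uv: "u \<in> tiled_square" "v \<in> tiled_square" using that p by auto
      have "p \<in> unit_square \<times> unit_square" using that by (auto simp: mem_Times_iff)
      then show ?thesis
        by (simp add: V_def w_def zero_extension_def p relabel_def graph_orderon_def vertex[OF uv(1)] vertex[OF uv(2)] G_def
            step_kernel_value[OF m1 uv] M_def)
    qed
    have "\<bar>LINT p:S \<times> T|lebesgue. V (fst p) (snd p)\<bar> \<le> (\<eta> + 11 / real L) + \<delta>"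
      if S: "S \<in> sets lebesgue" "S \<subseteq> unit_square" and T: "T \<in> sets lebesgue" "T \<subseteq> unit_square" for S T
    proof (cases "integrable lebesgue (\<lambda>p. indicat_real (S \<times> T) p *\<^sub>R V (fst p) (snd p))")
      case False
      then show ?thesis using \<eta> \<delta> by (simp add: set_lebesgue_integral_def not_integrable_integral_eq)
    next
      case True
      let ?E = "\<lambda>p. w p - step_kernel m D p"
      have ST: "S \<times> T \<in> sets lebesgue"
        using S T unit_square_lmeasurable(1) by (intro fmeasurableD lebesgue_Times(1)) (auto intro: fmeasurableI2)
      have int: "set_integrable lebesgue (S \<times> T) (step_kernel m M)" "set_integrable lebesgue (S \<times> T) ?E"
        using integrable_mult_indicator[OF ST step_kernel_integrable[OF m1]] integrable_mult_indicator[OF ST Eint]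
        by (simp_all add: set_integrable_def)
      have "(LINT p:S \<times> T|lebesgue. V (fst p) (snd p)) = (LINT p:S \<times> T|lebesgue. step_kernel m M p + ?E p)"
        unfolding set_lebesgue_integral_def
      proof (rule integral_cong_AE)
        show "(\<lambda>p. indicat_real (S \<times> T) p *\<^sub>R V (fst p) (snd p)) \<in> borel_measurable lebesgue"
          using True by (rule borel_measurable_integrable)
        show "(\<lambda>p. indicat_real (S \<times> T) p *\<^sub>R (step_kernel m M p + ?E p)) \<in> borel_measurable lebesgue"
          using set_integral_add(1)[OF int] unfolding set_integrable_def by (rule borel_measurable_integrable)
        show "AE p in lebesgue. indicat_real (S \<times> T) p *\<^sub>R V (fst p) (snd p)
            = indicat_real (S \<times> T) p *\<^sub>R (step_kernel m M p + ?E p)"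
          using AE_tiled
        proof eventually_elim
          fix p assume "p \<in> unit_square \<times> unit_square \<longrightarrow> p \<in> tiled_square \<times> tiled_square"
          moreover have "p \<in> S \<times> T \<Longrightarrow> p \<in> unit_square \<times> unit_square" using Sigma_mono[OF S(2) T(2)] by (rule subsetD)
          ultimately show "indicat_real (S \<times> T) p *\<^sub>R V (fst p) (snd p)
            = indicat_real (S \<times> T) p *\<^sub>R (step_kernel m M p + ?E p)"
            using V[of p] by (cases "p \<in> S \<times> T") auto
        qed
      qed
      also have "\<dots> = (LINT p:S \<times> T|lebesgue. step_kernel m M p) + (LINT p:S \<times> T|lebesgue. ?E p)"
        by (rule set_integral_add(2)[OF int])
      finally have split: "(LINT p:S \<times> T|lebesgue. V (fst p) (snd p))
        = (LINT p:S \<times> T|lebesgue. step_kernel m M p) + (LINT p:S \<times> T|lebesgue. ?E p)" .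
      have "\<bar>LINT p:S \<times> T|lebesgue. ?E p\<bar> \<le> (\<integral>p. \<bar>indicat_real (S \<times> T) p *\<^sub>R ?E p\<bar> \<partial>lebesgue)"
        unfolding set_lebesgue_integral_def by (rule integral_abs_bound)
      also have "\<dots> \<le> (\<integral>p. \<bar>?E p\<bar> \<partial>lebesgue)"
        using int(2) Eint unfolding set_integrable_def
        by (intro integral_mono integrable_abs) (auto simp: indicator_def)
      finally have "\<bar>LINT p:S \<times> T|lebesgue. ?E p\<bar> \<le> \<delta>" using Ele by linarith
      moreover have "\<bar>LINT p:S \<times> T|lebesgue. step_kernel m M p\<bar> \<le> \<eta> + 11 / real L"
        by (rule step_kernel_cut_bound[OF m1 S T]) (use cut in \<open>simp add: M_def\<close>)
      ultimately show ?thesis unfolding split by linarith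
    qed
    then have "cut_norm V \<le> (\<eta> + 11 / real L) + \<delta>" by (rule cut_norm_le)
    moreover have "cut_shift_dist W (graph_orderon n G) \<le> Shift f + cut_norm V"
      unfolding V_def[abs_def]
    proof (rule cut_shift_dist_le[OF f])
      show "W u v \<in> {0..1}" if "u \<in> unit_square" "v \<in> unit_square" for u v
        using W that unfolding orderon_def by blast
    qed (rule graph_orderon_range[OF G])
    ultimately have "cut_shift_dist W (graph_orderon n G) \<le> \<eta> + 12 / real L + \<delta>"
      using Shift by (simp add: field_simps)
    then show thesis using G that[of G] by (simp add: n_def)
  qed
qed

lemma identity_mp_bijection: "(\<lambda>u. u) \<in> mp_bijections"
  by (rule piecewise_affine_mp_bijection[where C = "{()}" and P = "\<lambda>_. unit_square" and R = "\<lambda>_. unit_square"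
        and \<alpha> = "\<lambda>_. 1" and \<beta> = "\<lambda>_. 0" and \<gamma> = "\<lambda>_. 1" and \<delta> = "\<lambda>_. 0"])
    (use unit_square_lmeasurable(1) in \<open>auto simp: disjoint_family_on_def fmeasurableD\<close>)

text \<open>For \<open>\<epsilon> \<ge> 1\<close> the bound on the number of vertices can be arbitrarily close to \<open>1\<close>; a single vertex
  meets it, and all values involved lie in \<open>[0, 1]\<close>, so the distance is at most \<open>1\<close>.\<close>

lemma edgeless_approx:
  assumes W: "orderon W"
  shows "simple_ordered_graph 1 (\<lambda>_ _. 0)" "cut_shift_dist W (graph_orderon 1 (\<lambda>_ _. 0)) \<le> 1"
proof -
  let ?U = "graph_orderon 1 (\<lambda>_ _. 0)"
  have W01: "W u v \<in> {0..1}" if "u \<in> unit_square" "v \<in> unit_square" for u v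
    using W that unfolding orderon_def by blast
  show G: "simple_ordered_graph 1 (\<lambda>_ _. 0)" by (simp add: simple_ordered_graph_def)
  have "cut_shift_dist W ?U \<le> Shift (\<lambda>u. u) + cut_norm (\<lambda>u v. W u v - relabel ?U (\<lambda>u. u) u v)"
    by (rule cut_shift_dist_le[OF identity_mp_bijection W01 graph_orderon_range[OF G]])
  also have "Shift (\<lambda>u. u) = 0" by (simp add: Shift_def)
  also have "cut_norm (\<lambda>u v. W u v - relabel ?U (\<lambda>u. u) u v) \<le> 1"
  proof (rule cut_norm_le, rule cut_integral_bound)
    show "\<bar>W u v - relabel ?U (\<lambda>u. u) u v\<bar> \<le> 1" if "u \<in> unit_square" "v \<in> unit_square" for u v
      using W01[OF that] by (simp add: relabel_def graph_orderon_def)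
  qed auto
  finally show "cut_shift_dist W ?U \<le> 1" by simp
qed

lemma vertex_count_bound:
  fixes \<epsilon> :: real
  assumes \<epsilon>: "0 < \<epsilon>" "\<epsilon> < 1"
  shows "real ((2 ^ nat \<lceil>16 / \<epsilon>\<^sup>2\<rceil> * nat \<lceil>64 / \<epsilon>\<rceil>)\<^sup>2) \<le> 2 powr (164 * \<epsilon> powr (-3))"
proof -
  define k L where "k = nat \<lceil>16 / \<epsilon>\<^sup>2\<rceil>" and "L = nat \<lceil>64 / \<epsilon>\<rceil>"
  have "real k \<le> 16 / \<epsilon>\<^sup>2 + 1" "real L \<le> 64 / \<epsilon> + 1"
    using \<epsilon> by (simp_all add: k_def L_def of_nat_nat ceiling_le_iff)
  moreover have "1 / \<epsilon>\<^sup>2 \<le> 1 / \<epsilon> ^ 3" "1 / \<epsilon> \<le> 1 / \<epsilon> ^ 3" "1 \<le> 1 / \<epsilon> ^ 3"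
    using \<epsilon> power_decreasing[of 2 3 \<epsilon>] power_decreasing[of 1 3 \<epsilon>] power_le_one[of \<epsilon> 3]
    by (auto intro!: divide_left_mono)
  ultimately have kL: "real (2 * (k + L)) \<le> 164 * (1 / \<epsilon> ^ 3)" by simp
  have "L < 2 ^ L" by (rule less_exp)
  then have "real L \<le> 2 ^ L" by (metis less_imp_le of_nat_le_iff of_nat_numeral of_nat_power)
  then have "(2 ^ k * real L)\<^sup>2 \<le> (2 ^ k * 2 ^ L)\<^sup>2" by (intro power_mono mult_left_mono) auto
  also have "\<dots> = 2 ^ (2 * (k + L))" by (simp add: power_add power_mult mult.commute flip: power_mult_distrib)
  also have "\<dots> = 2 powr real (2 * (k + L))" by (simp only: powr_realpow)
  also have "\<dots> \<le> 2 powr (164 * (1 / \<epsilon> ^ 3))" using kL by (intro powr_mono) auto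
  also have "1 / \<epsilon> ^ 3 = \<epsilon> powr (-3)" using \<epsilon> by (simp add: powr_minus_divide)
  finally show ?thesis by (simp add: k_def L_def)
qed

theorem corollary1p5:
  shows "\<exists>h :: real \<Rightarrow> real. (h \<longlongrightarrow> 0) (at_right 0) \<and>
    (\<forall>W \<epsilon>. orderon W \<longrightarrow> \<epsilon> > 0 \<longrightarrow>
      (\<exists>n G. simple_ordered_graph n G \<and>
         real n \<le> 2 powr (\<epsilon> powr (- 3 + h \<epsilon>)) \<and>
         cut_shift_dist W (graph_orderon n G) \<le> \<epsilon>))"
proof -
  define h :: "real \<Rightarrow> real" where "h \<epsilon> = ln 164 / ln \<epsilon>" for \<epsilon>
  have "(h \<longlongrightarrow> 0) (at_right 0)"
    unfolding h_def[abs_def]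
    by (rule tendsto_divide_0[OF tendsto_const filterlim_at_bot_imp_at_infinity[OF ln_at_0]])
  moreover have "\<exists>n G. simple_ordered_graph n G \<and> real n \<le> 2 powr (\<epsilon> powr (- 3 + h \<epsilon>)) \<and>
      cut_shift_dist W (graph_orderon n G) \<le> \<epsilon>" if W: "orderon W" and \<epsilon>: "\<epsilon> > 0" for W \<epsilon>
  proof (cases "\<epsilon> < 1")
    case False
    have "(1 :: real) = 2 powr 0" by simp
    also have "\<dots> \<le> 2 powr (\<epsilon> powr (- 3 + h \<epsilon>))" by (intro powr_mono) auto
    finally show ?thesis using edgeless_approx[OF W] False by (intro exI[of _ 1] exI[of _ "\<lambda>_ _. 0"]) auto
  next
    case True
    \<comment> \<open>The error \<open>\<epsilon>\<close> is shared as \<open>\<eta> = \<epsilon> / 4\<close> for regularity, \<open>\<epsilon> / 4\<close> for the \<open>L1\<close> approximation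
      and \<open>12 / L \<le> \<epsilon> / 4\<close> for the rest.\<close>
    define k L where "k = nat \<lceil>16 / \<epsilon>\<^sup>2\<rceil>" and "L = nat \<lceil>64 / \<epsilon>\<rceil>"
    have "real k \<ge> 16 / \<epsilon>\<^sup>2" "real L \<ge> 64 / \<epsilon>" unfolding k_def L_def by (rule real_nat_ceiling_ge)+
    then have k: "real k * (\<epsilon> / 4)\<^sup>2 \<ge> 1" and L\<epsilon>: "real L * \<epsilon> \<ge> 64"
      using \<epsilon> by (simp_all add: field_simps power2_eq_square)
    have L: "L \<ge> 1" using L\<epsilon> by (cases L) auto
    have "12 / real L \<le> \<epsilon> / 4" using L L\<epsilon> by (simp add: field_simps)
    obtain G where G: "simple_ordered_graph ((2 ^ k * L)\<^sup>2) G"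
      "cut_shift_dist W (graph_orderon ((2 ^ k * L)\<^sup>2) G) \<le> \<epsilon> / 4 + 12 / real L + \<epsilon> / 4"
      by (rule orderon_graph_approx[OF W _ k L, of "\<epsilon> / 4"]) (use \<epsilon> in auto)
    have "\<epsilon> powr h \<epsilon> = 164"
      using \<epsilon> True by (simp add: h_def powr_def)
    then have "\<epsilon> powr (- 3 + h \<epsilon>) = 164 * \<epsilon> powr (- 3)" by (simp only: powr_add mult.commute)
    then have "real ((2 ^ k * L)\<^sup>2) \<le> 2 powr (\<epsilon> powr (- 3 + h \<epsilon>))"
      using vertex_count_bound[OF \<epsilon> True] by (simp add: k_def L_def)
    moreover have "cut_shift_dist W (graph_orderon ((2 ^ k * L)\<^sup>2) G) \<le> \<epsilon>"
      using G(2) \<open>12 / real L \<le> \<epsilon> / 4\<close> \<epsilon> by linarith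
    ultimately show ?thesis using G(1) by blast
  qed
  ultimately show ?thesis by (intro exI[of _ h]) blast
qed

end
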